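(* Let $X$ be a set of reals (a subspace of $\mathbb{R}$). The following statements are equivalent: (1) $B(X)$ satisfies $S_{1}(\mathcal{S},\mathcal{S})$ and $B(X)$ is sequentially separable; (2) $X$ satisfies $S_{1}(B_{\Gamma}, B_{\Gamma})$; (3) $B(X)$ satisfies $S_{fin}(\mathcal{S},\mathcal{S})$ and $B(X)$ is sequentially separable; (4) $X$ satisfies $S_{fin}(B_{\Gamma}, B_{\Gamma})$; (5) $B_1(X)$ satisfies $S_{1}(\mathcal{S},\mathcal{S})$; (6) $X$ satisfies $S_{1}(F_{\Gamma}, F_{\Gamma})$; (7) $B_1(X)$ satisfies $S_{fin}(\mathcal{S},\mathcal{S})$.
   Context: $B(X)$ denotes the set of all real-valued Borel functions on $X$ and $B_1(X)$ the set of all real-valued functions of the first Baire class on $X$ (pointwise limits of sequences of continuous functions), both with the topology of pointwise convergence (subspace topology of $\mathbb{R}^X$). Selection principles: for families $\mathcal{A},\mathcal{B}$ of sets of subsets of a set, $S_1(\mathcal{A},\mathcal{B})$ means: for every sequence $(A_n:n\in\mathbb{N})$ of elements of $\mathcal{A}$ there are $b_n\in A_n$ with $\{b_n:n\in\mathbb{N}\}\in\mathcal{B}$; $S_{fin}(\mathcal{A},\mathcal{B})$ means: for every sequence $(A_n)$ of elements of $\mathcal{A}$ there are finite $B_n\subseteq A_n$ with $\bigcup_n B_n\in\mathcal{B}$. For a topological space $Y$: $\mathcal{S}$ is the family of all countable sequentially dense subsets of $Y$, where $D\subseteq Y$ is sequentially dense if every point of $Y$ is the limit of a sequence of points of $D$;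 $Y$ is sequentially separable if it has a countable sequentially dense subset. A cover $\mathcal{U}$ of $X$ is a $\gamma$-cover if it is infinite and each $x\in X$ belongs to all but finitely many members of $\mathcal{U}$. $B_\Gamma$ is the family of all countable $\gamma$-covers of $X$ by Borel sets, and $F_\Gamma$ is the family of all countable $\gamma$-covers of $X$ by closed sets. *)

theory Defs
  imports "HOL-Analysis.Analysis"
begin

definition S1 :: "'b set set \<Rightarrow> 'b set set \<Rightarrow> bool" where
  "S1 \<A> \<B> \<longleftrightarrow>
     (\<forall>A :: nat \<Rightarrow> 'b set. (\<forall>n. A n \<in> \<A>) \<longrightarrow>
        (\<exists>b :: nat \<Rightarrow> 'b. (\<forall>n. b n \<in> A n) \<and> range b \<in> \<B>))"

definition Sfin :: "'b set set \<Rightarrow> 'b set set \<Rightarrow> bool" where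
  "Sfin \<A> \<B> \<longleftrightarrow>
     (\<forall>A :: nat \<Rightarrow> 'b set. (\<forall>n. A n \<in> \<A>) \<longrightarrow>
        (\<exists>B :: nat \<Rightarrow> 'b set. (\<forall>n. finite (B n) \<and> B n \<subseteq> A n) \<and> (\<Union>n. B n) \<in> \<B>))"

definition seq_dense :: "'a topology \<Rightarrow> 'a set \<Rightarrow> bool" where
  "seq_dense T D \<longleftrightarrow> D \<subseteq> topspace T \<and>
     (\<forall>y\<in>topspace T. \<exists>s :: nat \<Rightarrow> 'a. (\<forall>n. s n \<in> D) \<and> limitin T s y sequentially)"

definition SeqD :: "'a topology \<Rightarrow> 'a set set" where
  "SeqD T = {D. countable D \<and> seq_dense T D}"

definition seq_separable :: "'a topology \<Rightarrow> bool" where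
  "seq_separable T \<longleftrightarrow> (\<exists>D. countable D \<and> seq_dense T D)"

text \<open>Functions on X are represented by extensional functions (value undefined off X);
  the pointwise topology is the subspace topology of the product topology on R^X.\<close>

definition Borel_funs :: "real set \<Rightarrow> (real \<Rightarrow> real) set" where
  "Borel_funs X = {f \<in> extensional X. f \<in> borel_measurable (restrict_space borel X)}"

definition Baire1_funs :: "real set \<Rightarrow> (real \<Rightarrow> real) set" where
  "Baire1_funs X = {f \<in> extensional X. \<exists>g :: nat \<Rightarrow> real \<Rightarrow> real.
      (\<forall>n. continuous_on X (g n)) \<and> (\<forall>x\<in>X. (\<lambda>n. g n x) \<longlonglongrightarrow> f x)}"

definition Bsp :: "real set \<Rightarrow> (real \<Rightarrow> real) topology" where
  "Bsp X = subtopology (product_topology (\<lambda>_. euclideanreal) X) (Borel_funs X)"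

definition B1sp :: "real set \<Rightarrow> (real \<Rightarrow> real) topology" where
  "B1sp X = subtopology (product_topology (\<lambda>_. euclideanreal) X) (Baire1_funs X)"

definition gamma_cover :: "'a set \<Rightarrow> 'a set set \<Rightarrow> bool" where
  "gamma_cover X \<U> \<longleftrightarrow> (\<forall>U\<in>\<U>. U \<subseteq> X) \<and> infinite \<U> \<and>
      (\<forall>x\<in>X. finite {U \<in> \<U>. x \<notin> U})"

definition BGamma :: "real set \<Rightarrow> real set set set" where
  "BGamma X = {\<U>. countable \<U> \<and> gamma_cover X \<U> \<and> \<U> \<subseteq> sets (restrict_space borel X)}"

definition FGamma :: "real set \<Rightarrow> real set set set" where
  "FGamma X = {\<U>. countable \<U> \<and> gamma_cover X \<U> \<and> (\<forall>U\<in>\<U>. closedin (top_of_set X) U)}"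

end

theory Submission
  imports Defs
begin

text \<open>
  All seven statements are equivalent to one diagonalisation property of the closed subsets
  of \<open>X\<close>: given increasing covers \<open>F n 0 \<subseteq> F n 1 \<subseteq> \<dots>\<close> of \<open>X\<close> for each \<open>n\<close>, some \<open>f\<close> has every
  \<open>x \<in> X\<close> in \<open>F n (f n)\<close> for almost all \<open>n\<close>.
  This property turns every \<open>G\<^sub>\<delta>\<close> subset of \<open>X\<close> into an \<open>F\<^sub>\<sigma>\<close> one, hence every Borel subset; so
  it extends from closed to Borel covers, and all Borel functions on \<open>X\<close> are of the first class.
  For \<open>S\<^sub>1\<close> of the function spaces, it is applied to the sets on which the tails of sequences
  converging to the members of a countable sequentially dense set are already close to the limit.
  Conversely, replacing the members \<open>d i\<close> of a sequentially dense set by the constant \<open>2\<close> outside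
  \<open>F n i\<close> gives sequentially dense sets, and a selection from them that approximates a constant
  below \<open>1\<close> has to pick indices \<open>i\<close> with \<open>x \<in> F n i\<close>.
\<close>

section \<open>Diagonal selection from increasing covers and selection of gamma-covers\<close>

text \<open>The class \<open>\<C>\<close> is a parameter because closed and Borel sets are both
  used. Unlike the members of a gamma-cover, the sets in a row \<open>F n\<close> may repeat and may
  equal \<open>X\<close>.\<close>

definition increasing_selection :: "'a set \<Rightarrow> 'a set set \<Rightarrow> bool" where
  "increasing_selection X \<C> \<longleftrightarrow>
     (\<forall>F :: nat \<Rightarrow> nat \<Rightarrow> 'a set.
        (\<forall>n m. F n m \<in> \<C>) \<and> (\<forall>n. incseq (F n)) \<and> (\<forall>n. (\<Union>m. F n m) = X) \<longrightarrow>
        (\<exists>f :: nat \<Rightarrow> nat. \<forall>x\<in>X. \<forall>\<^sub>F n in sequentially. x \<in> F n (f n)))"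

definition gamma_covers :: "'a set \<Rightarrow> 'a set set \<Rightarrow> 'a set set set" where
  "gamma_covers X \<C> = {\<U>. countable \<U> \<and> gamma_cover X \<U> \<and> \<U> \<subseteq> \<C>}"

lemma increasing_selectionD:
  fixes F :: "nat \<Rightarrow> nat \<Rightarrow> 'a set"
  assumes "increasing_selection X \<C>"
    and "\<And>n m. F n m \<in> \<C>" "\<And>n. incseq (F n)" "\<And>n. (\<Union>m. F n m) = X"
  shows "\<exists>f. \<forall>x\<in>X. \<forall>\<^sub>F n in sequentially. x \<in> F n (f n)"
  using assms unfolding increasing_selection_def by simp

lemma S1_imp_Sfin:
  assumes "S1 \<A> \<B>" shows "Sfin \<A> \<B>"
  unfolding Sfin_def
proof (intro allI impI)
  fix A :: "nat \<Rightarrow> 'a set"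
  assume "\<forall>n. A n \<in> \<A>"
  then obtain b where "\<forall>n. b n \<in> A n" "range b \<in> \<B>"
    using assms unfolding S1_def by blast
  then show "\<exists>B. (\<forall>n. finite (B n) \<and> B n \<subseteq> A n) \<and> (\<Union>n. B n) \<in> \<B>"
    by (intro exI[of _ "\<lambda>n. {b n}"]) (auto simp: UNION_singleton_eq_range)
qed

text \<open>Injectivity matters: without it a single member missing \<open>x\<close> could be listed
  infinitely often.\<close>

lemma gamma_cover_eventually:
  assumes "gamma_cover X \<U>" "inj_on V UNIV" "\<And>k::nat. V k \<in> \<U>" "x \<in> X"
  shows "\<forall>\<^sub>F k in sequentially. x \<in> V k"
proof -
  have "finite {U \<in> \<U>. x \<notin> U}"
    using assms by (auto simp: gamma_cover_def)
  then have "finite (V -` {U \<in> \<U>. x \<notin> U})"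
    using assms(2) by (rule finite_vimageI)
  moreover have "V -` {U \<in> \<U>. x \<notin> U} = {k. \<not> x \<in> V k}"
    using assms(3) by auto
  ultimately show ?thesis
    by (simp flip: cofinite_eq_sequentially add: eventually_cofinite)
qed

lemma gamma_cover_range:
  assumes "inj b" "\<And>n::nat. b n \<subseteq> X" "\<And>x. x \<in> X \<Longrightarrow> \<forall>\<^sub>F n in sequentially. x \<in> b n"
  shows "gamma_cover X (range b)"
  unfolding gamma_cover_def
proof (intro conjI ballI)
  show "infinite (range b)" using assms(1) by (simp add: finite_image_iff)
  fix x assume "x \<in> X"
  then have "finite {n. x \<notin> b n}"
    using assms(3)[of x] by (simp flip: cofinite_eq_sequentially add: eventually_cofinite)
  then have "finite (b ` {n. x \<notin> b n})" by simp
  then show "finite {U \<in> range b. x \<notin> U}"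
    by (rule rev_finite_subset) auto
qed (use assms in auto)

text \<open>At each stage only finitely many values are already taken, so a greedy choice can avoid
  them. This keeps the range of a selection infinite, as a gamma-cover has to be.\<close>

lemma injective_choice:
  fixes P :: "nat \<Rightarrow> 'a \<Rightarrow> bool"
  assumes "\<And>n. infinite {b. P n b}"
  shows "\<exists>b. inj b \<and> (\<forall>n. P n (b n))"
proof -
  have "\<exists>f. \<forall>n. (P n (f n) \<and> f n \<notin> f ` {..<n})"
  proof -
    define pick where "pick n (g::nat \<Rightarrow> 'a) = (SOME b. P n b \<and> b \<notin> g ` {..<n})" for n g
    have pick: "P n (pick n g) \<and> pick n g \<notin> g ` {..<n}" for n g
    proof -
      have "infinite ({b. P n b} - g ` {..<n})" using assms by simp
      then have "{b. P n b} - g ` {..<n} \<noteq> {}" by (metis finite.emptyI)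
      then have "\<exists>b. P n b \<and> b \<notin> g ` {..<n}" by auto
      then show ?thesis unfolding pick_def by (rule someI_ex)
    qed
    \<comment> \<open>Each choice depends on all earlier values, hence the well-founded recursion;
      \<open>cut\<close> agrees with \<open>f\<close> below \<open>n\<close>.\<close>
    define f where "f = wfrec less_than (\<lambda>g n. pick n g)"
    have f: "f n = pick n (cut f less_than n)" for n
      unfolding f_def by (subst wfrec) auto
    have "cut f less_than n ` {..<n} = f ` {..<n}" for n
      by (intro image_cong) (auto simp: cut_def)
    then show ?thesis using pick f by metis
  qed
  then obtain f where f: "\<And>n. P n (f n)" "\<And>n. f n \<notin> f ` {..<n}" by blast
  have "inj f"
    by (rule linorder_injI) (use f(2) in \<open>metis imageI lessThan_iff\<close>)
  with f show ?thesis by blast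
qed

text \<open>Intersecting the rows up to \<open>n\<close> makes the array decrease in the row index,
  so that a set chosen from a later row also serves every earlier one. The new rows still cover
  \<open>X\<close>, because the finitely many columns from which a point is captured have a
  maximum.\<close>

lemma finite_intersection_array:
  fixes F :: "nat \<Rightarrow> nat \<Rightarrow> 'a set"
  assumes Int: "\<And>A B. A \<in> \<C> \<Longrightarrow> B \<in> \<C> \<Longrightarrow> A \<inter> B \<in> \<C>"
    and F: "\<And>n m. F n m \<in> \<C>" "\<And>n. incseq (F n)" "\<And>n. (\<Union>m. F n m) = X"
  defines "E \<equiv> \<lambda>n m. \<Inter>i\<le>n. F i m"
  shows "E n m \<in> \<C>" "incseq (E n)" "(\<Union>m. E n m) = X"
    and "k \<le> n \<Longrightarrow> E n m \<subseteq> F k m"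
proof -
  show "E n m \<in> \<C>"
    unfolding E_def by (induction n) (auto simp: F(1) Int atMost_Suc)
  have inc: "incseq (E n)" for n
    unfolding E_def using F(2) by (intro monoI INF_mono') (simp add: incseqD)
  then show "incseq (E n)" .
  show "(\<Union>m. E n m) = X"
  proof (induction n)
    case 0 then show ?case using F(3)[of 0] by (simp add: E_def)
  next
    case (Suc n)
    have "x \<in> (\<Union>m. E (Suc n) m)" if x: "x \<in> X" for x
    proof -
      obtain a where "x \<in> E n a" using x Suc by blast
      moreover obtain b where "x \<in> F (Suc n) b" using x F(3)[of "Suc n"] by blast
      ultimately have "x \<in> E n (max a b)" "x \<in> F (Suc n) (max a b)"
        using inc[of n] F(2)[of "Suc n"]
        by (meson incseqD max.cobounded1 max.cobounded2 subsetD)+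
      then show ?thesis by (auto simp: E_def atMost_Suc)
    qed
    moreover have "E (Suc n) m \<subseteq> X" for m using F(3)[of 0] by (auto simp: E_def)
    ultimately show ?case by blast
  qed
  show "k \<le> n \<Longrightarrow> E n m \<subseteq> F k m" by (auto simp: E_def)
qed

text \<open>If the range were finite, its largest member would already be the union
  \<open>X\<close>.\<close>

lemma gamma_cover_increasing:
  fixes E :: "nat \<Rightarrow> 'a set"
  assumes "incseq E" "(\<Union>m. E m) = X" "\<And>m. E m \<noteq> X"
  shows "gamma_cover X (range E)"
  unfolding gamma_cover_def
proof (intro conjI ballI)
  show "infinite (range E)"
  proof
    assume fin: "finite (range E)"
    have "\<exists>m. \<Union>(E ` S) \<subseteq> E m" if "finite S" for S
    proof (intro exI UN_least)
      fix i assume "i \<in> S"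
      then show "E i \<subseteq> E (Max S)" using assms(1) that by (simp add: incseqD)
    qed
    moreover obtain S where "finite S" "range E = E ` S"
      using finite_subset_image[OF fin, of E UNIV] by auto
    ultimately obtain m where "X \<subseteq> E m" using assms(2) by metis
    then show False using assms(2,3) by blast
  qed
  fix x assume "x \<in> X"
  then obtain m where "x \<in> E m" using assms(2) by blast
  then have "{U \<in> range E. x \<notin> U} \<subseteq> E ` {..<m}"
    using assms(1) by (auto simp: incseq_def) (metis imageI lessThan_iff linorder_not_le subsetD)
  then show "finite {U \<in> range E. x \<notin> U}" by (rule finite_subset) simp
qed (use assms in auto)

text \<open>The selected finite sets have an infinite union, so members occur in arbitrarily late
  rows. Distinct members \<open>V k\<close> are taken from rows at or beyond \<open>k\<close>; as
  rows of \<open>E\<close> decrease, each lies in some set of \<open>F k\<close>, and distinctness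
  lets almost all of them contain a given point.\<close>

lemma increasing_selection_if_Sfin:
  assumes Int: "\<And>A B. A \<in> \<C> \<Longrightarrow> B \<in> \<C> \<Longrightarrow> A \<inter> B \<in> \<C>"
    and Sfin: "Sfin (gamma_covers X \<C>) (gamma_covers X \<C>)"
  shows "increasing_selection X \<C>"
  unfolding increasing_selection_def
proof (intro allI impI, elim conjE)
  fix F :: "nat \<Rightarrow> nat \<Rightarrow> 'a set"
  assume F: "\<forall>n m. F n m \<in> \<C>" "\<forall>n. incseq (F n)" "\<forall>n. (\<Union>m. F n m) = X"
  define E where "E = (\<lambda>n m. \<Inter>i\<le>n. F i m)"
  have E: "E n m \<in> \<C>" "incseq (E n)" "(\<Union>m. E n m) = X" "k \<le> n \<Longrightarrow> E n m \<subseteq> F k m"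
    for n m k
    unfolding E_def by (rule finite_intersection_array[of \<C> F X]; use Int F in simp)+
  show "\<exists>f. \<forall>x\<in>X. \<forall>\<^sub>F n in sequentially. x \<in> F n (f n)"
  proof (cases "\<forall>n. \<exists>m. E n m = X")
    case True
    then obtain f where "\<And>n. E n (f n) = X" by metis
    then have "\<forall>x\<in>X. \<forall>\<^sub>F n in sequentially. x \<in> F n (f n)"
      using E(4) by (intro ballI always_eventually allI) blast
    then show ?thesis by blast
  next
    case False
    \<comment> \<open>A row of \<open>E\<close> without the member \<open>X\<close> passes this on
      to all later rows, so from \<open>n0\<close> on every row is a genuine, infinite
      gamma-cover.\<close>
    then obtain n0 where n0: "\<And>m. E n0 m \<noteq> X" by blast
    have ne: "E (n0 + n) m \<noteq> X" for n m
    proof -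
      have "E (n0 + n) m \<subseteq> E n0 m" by (auto simp: E_def)
      moreover have "E n0 m \<subseteq> X" using E(3) by blast
      ultimately show ?thesis using n0[of m] by blast
    qed
    define A where "A n = range (E (n0 + n))" for n
    have "\<forall>n. A n \<in> gamma_covers X \<C>"
      using gamma_cover_increasing[OF E(2,3) ne] E(1)
      by (auto simp: A_def gamma_covers_def)
    then obtain B where B: "\<And>n. finite (B n)" "\<And>n. B n \<subseteq> A n" "(\<Union>n. B n) \<in> gamma_covers X \<C>"
      using Sfin[unfolded Sfin_def, rule_format, of A] by auto
    have gB: "gamma_cover X (\<Union>n. B n)" using B(3) by (simp add: gamma_covers_def)
    have "infinite {V. \<exists>n\<ge>k. V \<in> B n}" for k
    proof
      assume "finite {V. \<exists>n\<ge>k. V \<in> B n}"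
      moreover have "finite (\<Union>n<k. B n)" using B(1) by simp
      moreover have "(\<Union>n. B n) \<subseteq> {V. \<exists>n\<ge>k. V \<in> B n} \<union> (\<Union>n<k. B n)"
        using linorder_not_le by blast
      ultimately have "finite (\<Union>n. B n)" by (meson finite_UnI finite_subset)
      then show False using gB by (simp add: gamma_cover_def)
    qed
    then obtain V where V: "inj V" "\<And>k. \<exists>n\<ge>k. V k \<in> B n"
      using injective_choice[of "\<lambda>k V. \<exists>n\<ge>k. V \<in> B n"] by blast
    have "\<exists>m. V k \<subseteq> F k m" for k
    proof -
      obtain n where "n \<ge> k" "V k \<in> B n" using V(2) by blast
      then obtain m where "V k = E (n0 + n) m" using B(2)[of n] by (auto simp: A_def)
      then show ?thesis using E(4)[of k "n0 + n" m] \<open>n \<ge> k\<close> by auto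
    qed
    then obtain f where f: "\<And>k. V k \<subseteq> F k (f k)" by metis
    have "\<forall>\<^sub>F k in sequentially. x \<in> F k (f k)" if "x \<in> X" for x
    proof -
      have "V k \<in> (\<Union>n. B n)" for k using V(2) by blast
      from gamma_cover_eventually[OF gB V(1) this that] show ?thesis
        by eventually_elim (use f in blast)
    qed
    then show ?thesis by blast
  qed
qed

text \<open>The intersections of the tails of an enumerated gamma-cover form an increasing cover,
  which is why countable intersections must stay in \<open>\<C>\<close>. The set selected in row
  \<open>n\<close> lies in all \<open>U n k\<close> with \<open>k \<ge> f n\<close>; these are
  infinitely many sets, so the final choices can be made distinct.\<close>

lemma S1_if_increasing_selection:
  assumes Int: "\<And>A :: nat \<Rightarrow> 'a set. range A \<subseteq> \<C> \<Longrightarrow> (\<Inter>n. A n) \<in> \<C>"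
    and sel: "increasing_selection X \<C>"
  shows "S1 (gamma_covers X \<C>) (gamma_covers X \<C>)"
  unfolding S1_def
proof (intro allI impI)
  fix A :: "nat \<Rightarrow> 'a set set"
  assume A: "\<forall>n. A n \<in> gamma_covers X \<C>"
  have "\<forall>n. \<exists>U :: nat \<Rightarrow> 'a set. inj U \<and> range U = A n"
  proof
    fix n
    have "countable (A n)" "infinite (A n)" using A by (auto simp: gamma_covers_def gamma_cover_def)
    then have "bij_betw (from_nat_into (A n)) UNIV (A n)" by (rule bij_betw_from_nat_into)
    then show "\<exists>U :: nat \<Rightarrow> 'a set. inj U \<and> range U = A n"
      by (intro exI[of _ "from_nat_into (A n)"]) (auto simp: bij_betw_def)
  qed
  from choice[OF this] obtain U :: "nat \<Rightarrow> nat \<Rightarrow> 'a set"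
    where U: "\<And>n. inj (U n)" "\<And>n. range (U n) = A n" by blast
  define F where "F n m = (\<Inter>j. U n (m + j))" for n m
  have g: "gamma_cover X (A n)" "A n \<subseteq> \<C>" for n using A by (auto simp: gamma_covers_def)
  have memU: "U n j \<in> A n" for n j using U(2) by blast
  have FU: "F n m \<subseteq> U n k" if "m \<le> k" for n m k
    using that by (auto simp: F_def le_iff_add)
  have "F n m \<in> \<C>" for n m
    unfolding F_def using g(2) memU by (intro Int) blast
  moreover have "incseq (F n)" for n
  proof (rule incseq_SucI)
    fix m show "F n m \<subseteq> F n (Suc m)" unfolding F_def by (auto) (metis add_Suc_right)
  qed
  moreover have "(\<Union>m. F n m) = X" for n
  proof
    show "(\<Union>m. F n m) \<subseteq> X" using FU memU g(1) unfolding gamma_cover_def by blast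
    show "X \<subseteq> (\<Union>m. F n m)"
    proof
      fix x assume "x \<in> X"
      then have "\<forall>\<^sub>F j in sequentially. x \<in> U n j"
        by (rule gamma_cover_eventually[OF g(1) U(1) memU])
      then show "x \<in> (\<Union>m. F n m)" 
        by (auto simp: eventually_sequentially F_def) (metis le_add1)
    qed
  qed
  ultimately have "\<exists>f. \<forall>x\<in>X. \<forall>\<^sub>F n in sequentially. x \<in> F n (f n)"
    by (rule increasing_selectionD[OF sel])
  then obtain f where f: "\<forall>x\<in>X. \<forall>\<^sub>F n in sequentially. x \<in> F n (f n)" ..
  have "infinite {b. \<exists>k\<ge>f n. b = U n k}" for n
  proof -
    have "{b. \<exists>k\<ge>f n. b = U n k} = U n ` {f n..}" by auto
    moreover have "inj_on (U n) {f n..}" using U(1) by (rule inj_on_subset) simp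
    ultimately show ?thesis by (simp add: finite_image_iff infinite_Ici)
  qed
  then obtain b where b: "inj b" "\<And>n. \<exists>k\<ge>f n. b n = U n k"
    using injective_choice[of "\<lambda>n b. \<exists>k\<ge>f n. b = U n k"] by blast
  have bA: "b n \<in> A n" for n using b(2) memU by metis
  have "gamma_cover X (range b)"
  proof (rule gamma_cover_range[OF b(1)])
    show "b n \<subseteq> X" for n using bA[of n] g(1)[of n] by (simp add: gamma_cover_def)
    fix x assume "x \<in> X"
    with f have "\<forall>\<^sub>F n in sequentially. x \<in> F n (f n)" ..
    then show "\<forall>\<^sub>F n in sequentially. x \<in> b n"
      by eventually_elim (metis FU b(2) subsetD)
  qed
  then have "range b \<in> gamma_covers X \<C>" using bA g(2) by (auto simp: gamma_covers_def)
  then show "\<exists>b. (\<forall>n. b n \<in> A n) \<and> range b \<in> gamma_covers X \<C>" using bA by blast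
qed

section \<open>First Baire class functions and covers by F-sigma sets\<close>

text \<open>A form of the Lebesgue-Hausdorff condition that preimages of open sets are F-sigma,
  stated with covers on whose members \<open>f\<close> is nearly constant. The members may overlap.
  In a metric space it describes exactly the pointwise limits of continuous functions.\<close>

definition fsigma_approximable :: "'a::topological_space set \<Rightarrow> ('a \<Rightarrow> real) \<Rightarrow> bool" where
  "fsigma_approximable X f \<longleftrightarrow>
     (\<forall>e>0. \<exists>\<A>. countable \<A> \<and> X \<subseteq> \<Union>\<A> \<and>
        (\<forall>A\<in>\<A>. fsigma_in (top_of_set X) A \<and> (\<exists>q. \<forall>x\<in>A. \<bar>f x - q\<bar> \<le> e)))"

lemma fsigma_in_imp_countable_closed:
  assumes "fsigma_in T A"
  obtains \<U> where "countable \<U>" "\<And>U. U \<in> \<U> \<Longrightarrow> closedin T U" "\<Union>\<U> = A"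
  using assms unfolding fsigma_in_def union_of_def by blast

lemma fsigma_approximable_imp_closed_cover:
  assumes "fsigma_approximable X f" "e > 0"
  obtains K :: "nat \<Rightarrow> 'a::topological_space set" and q :: "nat \<Rightarrow> real"
  where "\<And>j. closed (K j)" "X \<subseteq> (\<Union>j. K j)" "\<And>j x. x \<in> X \<Longrightarrow> x \<in> K j \<Longrightarrow> \<bar>f x - q j\<bar> \<le> e"
proof -
  have "\<exists>\<A>. countable \<A> \<and> X \<subseteq> \<Union>\<A> \<and>
        (\<forall>A\<in>\<A>. fsigma_in (top_of_set X) A \<and> (\<exists>q. \<forall>x\<in>A. \<bar>f x - q\<bar> \<le> e))"
    using assms unfolding fsigma_approximable_def by simp
  then obtain \<A> where \<A>: "countable \<A>" "X \<subseteq> \<Union>\<A>" "\<forall>A\<in>\<A>. fsigma_in (top_of_set X) A"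
    and q: "\<forall>A\<in>\<A>. \<exists>q. \<forall>x\<in>A. \<bar>f x - q\<bar> \<le> e"
    by auto
  have "\<forall>A\<in>\<A>. \<exists>\<U>. countable \<U> \<and> (\<forall>U\<in>\<U>. closedin (top_of_set X) U) \<and> \<Union>\<U> = A"
  proof
    fix A assume "A \<in> \<A>"
    with \<A>(3) have "fsigma_in (top_of_set X) A" ..
    then show "\<exists>\<U>. countable \<U> \<and> (\<forall>U\<in>\<U>. closedin (top_of_set X) U) \<and> \<Union>\<U> = A"
      by (rule fsigma_in_imp_countable_closed) blast
  qed
  from bchoice[OF this] obtain \<U> where
    U: "\<forall>A\<in>\<A>. countable (\<U> A) \<and> (\<forall>U\<in>\<U> A. closedin (top_of_set X) U) \<and> \<Union>(\<U> A) = A" ..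
  then have \<U>: "countable (\<U> A)" "U \<in> \<U> A \<Longrightarrow> closedin (top_of_set X) U" "\<Union>(\<U> A) = A"
    if "A \<in> \<A>" for A U
    using that by simp_all
  \<comment> \<open>The empty set is added because \<open>from_nat_into\<close> enumerates only
    nonempty families, and the cover may be empty if \<open>X\<close> is.\<close>
  define \<V> where "\<V> = insert {} (\<Union>A\<in>\<A>. \<U> A)"
  have V: "countable \<V>" "\<V> \<noteq> {}" using \<A>(1) \<U>(1) by (auto simp: \<V>_def)
  have "X \<subseteq> (\<Union>A\<in>\<A>. \<Union>(\<U> A))" using \<A>(2) \<U>(3) by simp
  also have "\<dots> = \<Union>\<V>" by (auto simp: \<V>_def)
  finally have VX: "X \<subseteq> \<Union>\<V>" .
  have Vc: "\<exists>T q. closed T \<and> U = X \<inter> T \<and> (\<forall>x\<in>U. \<bar>f x - q\<bar> \<le> e)" if UV: "U \<in> \<V>" for U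
  proof (cases "U = {}")
    case True
    then show ?thesis by (intro exI[of _ "{}"] exI[of _ 0]) auto
  next
    case False
    then obtain A where A: "A \<in> \<A>" "U \<in> \<U> A" using UV by (auto simp: \<V>_def)
    then have "closedin (top_of_set X) U" "U \<subseteq> A" using \<U>(2)[OF A] \<U>(3)[OF A(1)] by blast+
    moreover obtain c where "\<forall>x\<in>A. \<bar>f x - c\<bar> \<le> e" using q A(1) by auto
    ultimately show ?thesis unfolding closedin_closed by blast
  qed
  have "\<forall>j. \<exists>p. closed (fst p) \<and> from_nat_into \<V> j = X \<inter> fst p \<and>
      (\<forall>x\<in>from_nat_into \<V> j. \<bar>f x - snd p\<bar> \<le> e)"
    using Vc[OF from_nat_into[OF V(2)]] by simp
  from choice[OF this] obtain p where p: "\<And>j. closed (fst (p j))"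
    "\<And>j. from_nat_into \<V> j = X \<inter> fst (p j)"
    "\<And>j. \<forall>x\<in>from_nat_into \<V> j. \<bar>f x - snd (p j)\<bar> \<le> e" by blast
  have "X \<subseteq> (\<Union>j. fst (p j))"
  proof
    fix x assume "x \<in> X"
    then obtain U where "U \<in> \<V>" "x \<in> U" using VX by blast
    moreover have "\<V> = range (from_nat_into \<V>)" using V by (simp add: range_from_nat_into)
    ultimately obtain j where "x \<in> from_nat_into \<V> j" by auto
    then show "x \<in> (\<Union>j. fst (p j))" using p(2) by auto
  qed
  moreover have "\<bar>f x - snd (p j)\<bar> \<le> e" if "x \<in> X" "x \<in> fst (p j)" for j x
    using p(3)[of j] that unfolding p(2) by blast
  ultimately show thesis using that[of "\<lambda>j. fst (p j)" "\<lambda>j. snd (p j)"] p(1) by blast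
qed

text \<open>Truncating \<open>1 - N * infdist x C\<close> at 0 makes the values off \<open>C\<close>
  not just small but eventually 0, so that products of such functions can be evaluated
  exactly.\<close>

lemma closed_indicator_limit:
  fixes C :: "'a::metric_space set"
  assumes "closed C"
  obtains w :: "nat \<Rightarrow> 'a \<Rightarrow> real"
  where "\<And>N. continuous_on UNIV (w N)" "\<And>N x. x \<in> C \<Longrightarrow> w N x = 1"
    "\<And>x. x \<notin> C \<Longrightarrow> \<forall>\<^sub>F N in sequentially. w N x = 0"
proof (cases "C = {}")
  \<comment> \<open>Since \<open>infdist x {}\<close> is 0, the general formula would give the
    constant 1 here.\<close>
  case True
  then show thesis by (intro that[of "\<lambda>_ _. 0"]) auto
next
  case False
  show thesis
  proof (rule that[of "\<lambda>N x. max 0 (1 - real N * infdist x C)"])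
    show "continuous_on UNIV (\<lambda>x. max 0 (1 - real N * infdist x C))" for N
      by (intro continuous_intros)
    show "max 0 (1 - real N * infdist x C) = 1" if "x \<in> C" for N x
      using that by simp
    fix x assume "x \<notin> C"
    then have pos: "infdist x C > 0"
      using assms False by (simp add: infdist_pos_not_in_closed)
    obtain M :: nat where "1 / infdist x C < real M" using reals_Archimedean2 by blast
    then have M: "1 < real M * infdist x C" using pos by (simp add: field_simps)
    show "\<forall>\<^sub>F N in sequentially. max 0 (1 - real N * infdist x C) = 0"
      using eventually_ge_at_top[of M]
    proof eventually_elim
      case (elim N)
      then have "real M * infdist x C \<le> real N * infdist x C"
        using pos by (intro mult_right_mono) auto
      then show ?case using M by simp
    qed
  qed
qed

lemma closed_cover_step_limit:
  fixes K :: "nat \<Rightarrow> 'a::metric_space set" and q :: "nat \<Rightarrow> real"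
  assumes "\<And>j. closed (K j)"
  obtains h :: "nat \<Rightarrow> 'a \<Rightarrow> real" where "\<And>N. continuous_on UNIV (h N)"
    "\<And>x. x \<in> (\<Union>j. K j) \<Longrightarrow> \<exists>j. x \<in> K j \<and> (\<forall>\<^sub>F N in sequentially. h N x = q j)"
proof -
  have "\<forall>j. \<exists>w :: nat \<Rightarrow> 'a \<Rightarrow> real. (\<forall>N. continuous_on UNIV (w N)) \<and> (\<forall>N. \<forall>x\<in>K j. w N x = 1) \<and>
    (\<forall>x. x \<notin> K j \<longrightarrow> (\<forall>\<^sub>F N in sequentially. w N x = 0))"
    using closed_indicator_limit[OF assms] by metis
  from choice[OF this] obtain w :: "nat \<Rightarrow> nat \<Rightarrow> 'a \<Rightarrow> real"
    where w: "\<And>j N. continuous_on UNIV (w j N)" "\<And>j N x. x \<in> K j \<Longrightarrow> w j N x = 1"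
    "\<And>j x. x \<notin> K j \<Longrightarrow> \<forall>\<^sub>F N in sequentially. w j N x = 0" by blast
  \<comment> \<open>Each term imitates the indicator of \<open>K c\<close> minus the earlier sets.
    If \<open>c\<close> is the first index with \<open>x\<close> in \<open>K c\<close>, the factor
    \<open>1 - w c N x\<close> kills all later terms for every \<open>N\<close>, so only the
    finitely many \<open>w i\<close> with \<open>i < c\<close> have to settle.\<close>
  define h where "h N x = (\<Sum>c<N. q c * w c N x * (\<Prod>i<c. 1 - w i N x))" for N x
  show thesis
  proof (rule that[of h])
    show "continuous_on UNIV (h N)" for N
      unfolding h_def by (intro continuous_intros w(1))
    fix x assume "x \<in> (\<Union>j. K j)"
    then have ex: "\<exists>j. x \<in> K j" by blast
    define c where "c = (LEAST j. x \<in> K j)"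
    have c: "x \<in> K c" unfolding c_def using ex by (rule LeastI_ex)
    have "x \<notin> K i" if "i < c" for i using that unfolding c_def by (rule not_less_Least)
    then have "\<forall>\<^sub>F N in sequentially. \<forall>i\<in>{..<c}. w i N x = 0"
      using w(3) by (intro eventually_ball_finite) auto
    then have "\<forall>\<^sub>F N in sequentially. h N x = q c"
      using eventually_gt_at_top[of c]
    proof eventually_elim
      case (elim N)
      have "q i * w i N x * (\<Prod>j<i. 1 - w j N x) = (if i = c then q c else 0)" for i
      proof (cases i c rule: linorder_cases)
        case greater
        then have "(\<Prod>j<i. 1 - w j N x) = 0" using w(2)[OF c] by (intro prod_zero) auto
        then show ?thesis using greater by simp
      qed (use elim w(2)[OF c] in auto)
      then show ?case using elim(2) by (simp add: h_def)
    qed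
    then show "\<exists>j. x \<in> K j \<and> (\<forall>\<^sub>F N in sequentially. h N x = q j)" using c by blast
  qed
qed

text \<open>Uniform limits of limits: clamp each approximation to within a summable distance of
  the preceding one and take the diagonal.\<close>

lemma fsigma_approximable_imp_limit:
  fixes X :: "'a::metric_space set"
  assumes f: "fsigma_approximable X f"
  obtains g :: "nat \<Rightarrow> 'a \<Rightarrow> real" where "\<And>n. continuous_on UNIV (g n)"
    "\<And>x. x \<in> X \<Longrightarrow> (\<lambda>n. g n x) \<longlonglongrightarrow> f x"
proof -
  have "\<forall>k::nat. \<exists>h :: nat \<Rightarrow> 'a \<Rightarrow> real. (\<forall>N. continuous_on UNIV (h N)) \<and>
     (\<forall>x\<in>X. \<forall>\<^sub>F N in sequentially. \<bar>h N x - f x\<bar> \<le> (1/2)^k)"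
  proof
    fix k :: nat
    obtain K :: "nat \<Rightarrow> 'a set" and q where K: "\<And>j. closed (K j)" "X \<subseteq> (\<Union>j. K j)"
      "\<And>j x. x \<in> X \<Longrightarrow> x \<in> K j \<Longrightarrow> \<bar>f x - q j\<bar> \<le> (1/2)^k"
      using fsigma_approximable_imp_closed_cover[OF f, of "(1/2)^k"] by auto
    obtain h :: "nat \<Rightarrow> 'a \<Rightarrow> real" where h: "\<And>N. continuous_on UNIV (h N)"
      "\<And>x. x \<in> (\<Union>j. K j) \<Longrightarrow> \<exists>j. x \<in> K j \<and> (\<forall>\<^sub>F N in sequentially. h N x = q j)"
      using closed_cover_step_limit[of K q] K(1) by metis
    have "\<forall>\<^sub>F N in sequentially. \<bar>h N x - f x\<bar> \<le> (1/2)^k" if x: "x \<in> X" for x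
    proof -
      obtain j where "x \<in> K j" and ev: "\<forall>\<^sub>F N in sequentially. h N x = q j"
        using h(2) K(2) x by blast
      then have "\<bar>f x - q j\<bar> \<le> (1/2)^k" using K(3) x by blast
      with ev show ?thesis by (auto elim!: eventually_mono simp: abs_minus_commute)
    qed
    with h(1) show "\<exists>h :: nat \<Rightarrow> 'a \<Rightarrow> real. (\<forall>N. continuous_on UNIV (h N)) \<and>
     (\<forall>x\<in>X. \<forall>\<^sub>F N in sequentially. \<bar>h N x - f x\<bar> \<le> (1/2)^k)" by blast
  qed
  from choice[OF this] obtain h :: "nat \<Rightarrow> nat \<Rightarrow> 'a \<Rightarrow> real"
    where h: "\<And>k N. continuous_on UNIV (h k N)"
      "\<And>k x. x \<in> X \<Longrightarrow> \<forall>\<^sub>F N in sequentially. \<bar>h k N x - f x\<bar> \<le> (1/2)^k" by blast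
  \<comment> \<open>The clamp width \<open>2 * (1/2)^k\<close> exceeds the combined errors
    \<open>(1/2)^k\<close> and \<open>(1/2)^(k+1)\<close> of two good consecutive approximations. So
    the clamp does not act as long as all approximations so far are good.\<close>
  define H where "H k N x = rec_nat (h 0 N x)
     (\<lambda>k y. max (y - 2 * (1/2)^k) (min (y + 2 * (1/2)^k) (h (Suc k) N x))) k" for k N x
  have H0: "H 0 N x = h 0 N x" for N x by (simp add: H_def)
  have HS: "H (Suc k) N x = max (H k N x - 2 * (1/2)^k) (min (H k N x + 2 * (1/2)^k) (h (Suc k) N x))"
    for k N x by (simp add: H_def)
  have cont: "continuous_on UNIV (H k N)" for k N
  proof (induction k)
    case 0
    have "H 0 N = h 0 N" using H0 by blast
    then show ?case using h(1) by simp
  next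
    case (Suc k)
    have "H (Suc k) N = (\<lambda>x. max (H k N x - 2 * (1/2)^k) (min (H k N x + 2 * (1/2)^k) (h (Suc k) N x)))"
      using HS by blast
    then show ?case using Suc h(1) by (auto intro!: continuous_intros)
  qed
  have Hh: "H k N x = h k N x" if "k \<le> m" "\<forall>k\<in>{..m}. \<bar>h k N x - f x\<bar> \<le> (1/2)^k" for k m N x
    using that(1)
  proof (induction k)
    case 0 show ?case by (rule H0)
  next
    case (Suc k)
    have p: "(1/2::real) ^ Suc k = (1/2)^k / 2" "(1/2::real)^k > 0" by simp_all
    have "\<bar>h k N x - f x\<bar> \<le> (1/2)^k" "\<bar>h (Suc k) N x - f x\<bar> \<le> (1/2)^Suc k"
      using that(2) Suc.prems Suc_leD by blast+
    then have "\<bar>h (Suc k) N x - h k N x\<bar> \<le> 2 * (1/2)^k" using p by linarith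
    moreover have "H k N x = h k N x" using Suc by simp
    ultimately show ?case unfolding HS by linarith
  qed
  \<comment> \<open>The bound is the geometric sum of the clamp widths. It holds for all
    \<open>N\<close> and \<open>x\<close>, also where the later \<open>h k N\<close> are still far
    from \<open>f\<close>.\<close>
  have Hd: "\<bar>H n N x - H m N x\<bar> \<le> 4 * (1/2)^m - 4 * (1/2)^n" if "m \<le> n" for m n N x
    using that
  proof (induction n rule: dec_induct)
    case (step n)
    have p: "(1/2::real) ^ Suc n = (1/2)^n / 2" "(1/2::real)^n > 0" by simp_all
    have "\<bar>H (Suc n) N x - H n N x\<bar> \<le> 2 * (1/2)^n" unfolding HS using p by linarith
    then show ?case using step.IH p by linarith
  qed simp
  show thesis
  proof (rule that[of "\<lambda>N. H N N"])
    show "continuous_on UNIV (H N N)" for N by (rule cont)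
    fix x assume x: "x \<in> X"
    show "(\<lambda>N. H N N x) \<longlonglongrightarrow> f x"
    proof (rule tendstoI)
      fix e :: real assume "e > 0"
      \<comment> \<open>One fifth covers the error of \<open>h m\<close>, the other four cover the
        drift from \<open>H m\<close> to \<open>H N\<close>.\<close>
      then obtain m where m: "(1/2::real)^m < e / 5"
        using real_arch_pow_inv[of "e/5" "1/2"] by auto
      have "\<forall>\<^sub>F N in sequentially. \<forall>k\<in>{..m}. \<bar>h k N x - f x\<bar> \<le> (1/2)^k"
        using h(2)[OF x] by (intro eventually_ball_finite) auto
      then show "\<forall>\<^sub>F N in sequentially. dist (H N N x) (f x) < e"
        using eventually_ge_at_top[of m]
      proof eventually_elim
        case (elim N)
        have "H m N x = h m N x" using Hh[of m m] elim(1) by simp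
        moreover have "\<bar>h m N x - f x\<bar> \<le> (1/2)^m" using elim(1) by simp
        moreover have "(1/2::real)^N > 0" by simp
        ultimately show ?case using Hd[OF elim(2), of N x] m unfolding dist_real_def by linarith
      qed
    qed
  qed
qed

text \<open>The points whose tail from \<open>m\<close> on stays within \<open>e\<close> of a
  rational \<open>q\<close> form a closed set; countably many such sets cover \<open>X\<close>, and
  the bound passes to the limit.\<close>

lemma limit_imp_fsigma_approximable:
  fixes g :: "nat \<Rightarrow> 'a::topological_space \<Rightarrow> real"
  assumes g: "\<And>n. continuous_on X (g n)" "\<And>x. x \<in> X \<Longrightarrow> (\<lambda>n. g n x) \<longlonglongrightarrow> f x"
  shows "fsigma_approximable X f"
  unfolding fsigma_approximable_def
proof (intro allI impI)
  fix e :: real assume e: "e > 0"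
  define D where "D m q = {x\<in>X. \<forall>j\<ge>m. \<bar>g j x - q\<bar> \<le> e}" for m :: nat and q
  define \<A> where "\<A> = (\<lambda>(m,q). D m q) ` (UNIV \<times> \<rat>)"
  have "countable \<A>" unfolding \<A>_def by (intro countable_image countable_SIGMA countable_rat) auto
  moreover have "X \<subseteq> \<Union>\<A>"
  proof
    fix x assume x: "x \<in> X"
    obtain q where q: "q \<in> \<rat>" "f x - e/2 < q" "q < f x + e/2"
      using Rats_dense_in_real[of "f x - e/2" "f x + e/2"] e by auto
    have "\<forall>\<^sub>F n in sequentially. dist (g n x) (f x) < e/2"
      using g(2)[OF x] e by (intro tendstoD) auto
    then obtain m where "\<And>n. n \<ge> m \<Longrightarrow> dist (g n x) (f x) < e/2"
      by (auto simp: eventually_sequentially)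
    then have "\<bar>g j x - q\<bar> \<le> e" if "j \<ge> m" for j
      using q that unfolding dist_real_def by (smt (verit) field_sum_of_halves)
    then have "x \<in> D m q" using x by (simp add: D_def)
    then show "x \<in> \<Union>\<A>" using q(1) unfolding \<A>_def by force
  qed
  moreover have "fsigma_in (top_of_set X) (D m q)" for m q
  proof (rule closed_imp_fsigma_in)
    have "D m q = (\<Inter>j\<in>{m..}. X \<inter> (\<lambda>x. \<bar>g j x - q\<bar>) -` {..e})" by (auto simp: D_def)
    moreover have "closedin (top_of_set X) (X \<inter> (\<lambda>x. \<bar>g j x - q\<bar>) -` {..e})" for j
      by (intro continuous_closedin_preimage continuous_intros g(1))
    ultimately show "closedin (top_of_set X) (D m q)"
      by (simp only:) (intro closedin_INT; auto)
  qed
  moreover have "\<bar>f x - q\<bar> \<le> e" if "x \<in> D m q" for m q x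
  proof (rule tendsto_upperbound)
    show "(\<lambda>n. \<bar>g n x - q\<bar>) \<longlonglongrightarrow> \<bar>f x - q\<bar>"
      using that by (intro tendsto_intros g(2)) (auto simp: D_def)
    show "\<forall>\<^sub>F n in sequentially. \<bar>g n x - q\<bar> \<le> e"
      using eventually_ge_at_top[of m] by eventually_elim (use that in \<open>simp add: D_def\<close>)
  qed simp
  ultimately show "\<exists>\<A>. countable \<A> \<and> X \<subseteq> \<Union>\<A> \<and>
     (\<forall>A\<in>\<A>. fsigma_in (top_of_set X) A \<and> (\<exists>q. \<forall>x\<in>A. \<bar>f x - q\<bar> \<le> e))"
    by (intro exI[of _ \<A>]) (fastforce simp: \<A>_def)
qed

section \<open>Borel sets under the selection property\<close>

text \<open>Write \<open>G\<close> as a decreasing intersection of open \<open>U n\<close>, and each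
  \<open>U n\<close> as an increasing union of closed \<open>C n m\<close>. Adding the closed
  complement of \<open>U n\<close> turns row \<open>n\<close> into a cover of \<open>X\<close>. On
  \<open>G\<close> the complements are irrelevant, so the selected \<open>C n (f n)\<close> contain
  almost always each point of \<open>G\<close>; conversely such a point lies in every
  \<open>U n\<close>, as these decrease.\<close>

lemma gdelta_imp_fsigma_if_selection:
  fixes X :: "'a::metric_space set"
  assumes sel: "increasing_selection X {C. closedin (top_of_set X) C}"
    and G: "gdelta_in (top_of_set X) G"
  shows "fsigma_in (top_of_set X) G"
proof -
  obtain U where U: "\<forall>n::nat. openin (top_of_set X) (U n)" "\<forall>n. U (Suc n) \<subseteq> U n" "\<Inter>(range U) = G"
    using G unfolding gdelta_in_descending by auto
  have "\<forall>n. \<exists>C::nat \<Rightarrow> 'a set. (\<forall>m. closedin (top_of_set X) (C m)) \<and> (\<forall>m. C m \<subseteq> C (Suc m)) \<and> \<Union>(range C) = U n"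
  proof
    fix n
    have "fsigma_in (top_of_set X) (U n)"
      using U(1) by (intro open_imp_fsigma_in metrizable_space_subtopology metrizable_space_euclidean) simp
    then show "\<exists>C::nat \<Rightarrow> 'a set. (\<forall>m. closedin (top_of_set X) (C m)) \<and> (\<forall>m. C m \<subseteq> C (Suc m)) \<and> \<Union>(range C) = U n"
      by (simp add: fsigma_in_ascending)
  qed
  from choice[OF this] obtain C :: "nat \<Rightarrow> nat \<Rightarrow> 'a set" where C':
    "\<forall>n. (\<forall>m. closedin (top_of_set X) (C n m)) \<and> (\<forall>m. C n m \<subseteq> C n (Suc m)) \<and> \<Union>(range (C n)) = U n" ..
  then have C: "closedin (top_of_set X) (C n m)" "C n m \<subseteq> C n (Suc m)" "\<Union>(range (C n)) = U n" for n m
    by simp_all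
  have UX: "U n \<subseteq> X" for n using U(1) openin_imp_subset by blast
  define F where "F n m = (X - U n) \<union> C n m" for n m
  have "\<exists>f. \<forall>x\<in>X. \<forall>\<^sub>F n in sequentially. x \<in> F n (f n)"
  proof (rule increasing_selectionD[OF sel])
    have "closedin (top_of_set X) (X - U n)" for n
      using U(1) by (simp add: closedin_diff)
    then show "F n m \<in> {C. closedin (top_of_set X) C}" for n m
      using C(1) by (simp add: F_def closedin_Un)
    show "incseq (F n)" for n
    proof (rule incseq_SucI)
      show "F n m \<subseteq> F n (Suc m)" for m using C(2)[of n m] by (auto simp: F_def)
    qed
    have "(\<Union>m. F n m) = (X - U n) \<union> \<Union>(range (C n))" for n by (auto simp: F_def)
    then show "(\<Union>m. F n m) = X" for n using C(3) UX[of n] by auto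
  qed
  then obtain f where f: "\<forall>x\<in>X. \<forall>\<^sub>F n in sequentially. x \<in> F n (f n)" ..
  have "G = (\<Union>N. \<Inter>n\<in>{N..}. C n (f n))"
  proof (intro equalityI subsetI)
    fix x assume x: "x \<in> G"
    then have xU: "x \<in> U n" for n using U(3) by blast
    then have "\<forall>\<^sub>F n in sequentially. x \<in> F n (f n)" using f UX by blast
    then have "\<forall>\<^sub>F n in sequentially. x \<in> C n (f n)"
      by eventually_elim (use xU in \<open>simp add: F_def\<close>)
    then show "x \<in> (\<Union>N. \<Inter>n\<in>{N..}. C n (f n))" by (auto simp: eventually_sequentially)
  next
    fix x assume "x \<in> (\<Union>N. \<Inter>n\<in>{N..}. C n (f n))"
    then obtain N where N: "\<And>n. n \<ge> N \<Longrightarrow> x \<in> C n (f n)" by auto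
    have "decseq U" using U(2) by (simp add: decseq_Suc_iff)
    have "x \<in> U n" for n
    proof -
      have "x \<in> C (max n N) (f (max n N))" using N by simp
      then have "x \<in> U (max n N)" using C(3)[of "max n N"] by blast
      moreover have "U (max n N) \<subseteq> U n" using \<open>decseq U\<close> by (simp add: decseqD)
      ultimately show ?thesis by blast
    qed
    then show "x \<in> G" using U(3) by auto
  qed
  moreover have "fsigma_in (top_of_set X) (\<Union>N. \<Inter>n\<in>{N..}. C n (f n))"
  proof (rule fsigma_in_Union)
    fix S assume "S \<in> range (\<lambda>N. \<Inter>n\<in>{N..}. C n (f n))"
    then obtain N where S: "S = (\<Inter>n\<in>{N..}. C n (f n))" by auto
    show "fsigma_in (top_of_set X) S"
      unfolding S by (intro closed_imp_fsigma_in closedin_INT C(1)) auto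
  qed simp
  ultimately show ?thesis by simp
qed

text \<open>G-delta and F-sigma are carried together through the induction over the Borel sets,
  because complements exchange them. For a countable union, the complement is G-delta, hence F-sigma
  by the preceding lemma, and so the union is G-delta.\<close>

lemma borel_imp_fsigma_if_selection:
  fixes X :: "'a::metric_space set"
  assumes sel: "increasing_selection X {C. closedin (top_of_set X) C}"
    and A: "A \<in> sets (restrict_space borel X)"
  shows "fsigma_in (top_of_set X) A"
proof -
  obtain B where B: "B \<in> sets borel" "A = X \<inter> B"
    using A by (auto simp: sets_restrict_space)
  have "B \<in> sigma_sets UNIV {S. open S}"
    using B(1) by (simp add: borel_def)
  then have "gdelta_in (top_of_set X) (X \<inter> B) \<and> fsigma_in (top_of_set X) (X \<inter> B)"
  proof induction
    case (Basic S)
    then have "gdelta_in (top_of_set X) (X \<inter> S)"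
      by (intro open_imp_gdelta_in) (auto simp: openin_open)
    then show ?case using gdelta_imp_fsigma_if_selection[OF sel] by blast
  next
    case Empty then show ?case by simp
  next
    case (Compl S)
    have "X \<inter> (UNIV - S) = X - X \<inter> S" by blast
    then show ?case
      using Compl gdelta_in_fsigma_in[of "top_of_set X" "X - X \<inter> S"]
        fsigma_in_gdelta_in[of "top_of_set X" "X - X \<inter> S"]
      by (simp add: double_diff)
  next
    case (Union S)
    have eq: "X \<inter> \<Union>(range S) = \<Union>(range (\<lambda>i. X \<inter> S i))" by blast
    have "gdelta_in (top_of_set X) (X - X \<inter> S i)" for i
      using Union.IH[of i] fsigma_in_gdelta_in[of "top_of_set X" "X \<inter> S i"] by simp
    then have "gdelta_in (top_of_set X) (\<Inter>(range (\<lambda>i. X - X \<inter> S i)))"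
      by (intro gdelta_in_Inter) auto
    then have "fsigma_in (top_of_set X) (\<Inter>(range (\<lambda>i. X - X \<inter> S i)))"
      by (rule gdelta_imp_fsigma_if_selection[OF sel])
    moreover have "(\<Inter>(range (\<lambda>i. X - X \<inter> S i))) = X - X \<inter> \<Union>(range S)" by blast
    ultimately have "gdelta_in (top_of_set X) (X \<inter> \<Union>(range S))"
      using gdelta_in_fsigma_in[of "top_of_set X" "X \<inter> \<Union>(range S)"] by simp
    then show ?case using gdelta_imp_fsigma_if_selection[OF sel] by blast
  qed
  with B show ?thesis by blast
qed

text \<open>Each \<open>F n m\<close> is an increasing union of closed sets \<open>C n m k\<close>.
  The finite unions of \<open>C n m k\<close> over \<open>m \<le> k\<close> are closed, increase
  with \<open>k\<close>, still cover \<open>X\<close> and lie inside \<open>F n k\<close>, so a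
  selection among them serves \<open>F\<close>.\<close>

lemma increasing_selection_borel:
  fixes X :: "'a::metric_space set"
  assumes sel: "increasing_selection X {C. closedin (top_of_set X) C}"
  shows "increasing_selection X (sets (restrict_space borel X))"
  unfolding increasing_selection_def
proof (intro allI impI, elim conjE)
  fix F :: "nat \<Rightarrow> nat \<Rightarrow> 'a set"
  assume F: "\<forall>n m. F n m \<in> sets (restrict_space borel X)" "\<forall>n. incseq (F n)" "\<forall>n. (\<Union>m. F n m) = X"
  have "\<forall>n. \<forall>m. \<exists>C::nat \<Rightarrow> 'a set. (\<forall>k. closedin (top_of_set X) (C k)) \<and> (\<forall>k. C k \<subseteq> C (Suc k)) \<and> \<Union>(range C) = F n m"
  proof (intro allI)
    fix n m
    have "fsigma_in (top_of_set X) (F n m)"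
      using F(1) by (intro borel_imp_fsigma_if_selection[OF sel]) simp
    then show "\<exists>C::nat \<Rightarrow> 'a set. (\<forall>k. closedin (top_of_set X) (C k)) \<and> (\<forall>k. C k \<subseteq> C (Suc k)) \<and> \<Union>(range C) = F n m"
      by (simp add: fsigma_in_ascending)
  qed
  then have "\<forall>n. \<exists>C. \<forall>m. (\<forall>k::nat. closedin (top_of_set X) (C m k)) \<and> (\<forall>k. C m k \<subseteq> C m (Suc k)) \<and> \<Union>(range (C m)) = F n m"
    by (intro allI choice) simp
  from choice[OF this] obtain C :: "nat \<Rightarrow> nat \<Rightarrow> nat \<Rightarrow> 'a set" where
    "\<forall>n m. (\<forall>k. closedin (top_of_set X) (C n m k)) \<and> (\<forall>k. C n m k \<subseteq> C n m (Suc k)) \<and> \<Union>(range (C n m)) = F n m" ..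
  then have C: "closedin (top_of_set X) (C n m k)" "incseq (C n m)" "(\<Union>k. C n m k) = F n m" for n m k
    by (simp_all add: incseq_Suc_iff)
  define F' where "F' n k = (\<Union>m\<le>k. C n m k)" for n k
  have sub: "F' n k \<subseteq> F n k" for n k
  proof -
    have "C n m k \<subseteq> F n k" if "m \<le> k" for m
    proof -
      have "C n m k \<subseteq> F n m" using C(3)[of n m] by blast
      also have "\<dots> \<subseteq> F n k" using F(2) that by (simp add: incseqD)
      finally show ?thesis .
    qed
    then show ?thesis by (auto simp: F'_def)
  qed
  have "\<exists>f. \<forall>x\<in>X. \<forall>\<^sub>F n in sequentially. x \<in> F' n (f n)"
  proof (rule increasing_selectionD[OF sel])
    show "F' n k \<in> {C. closedin (top_of_set X) C}" for n k
      unfolding F'_def using C(1) by (auto intro!: closedin_Union)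
    show "incseq (F' n)" for n
    proof (rule monoI)
      fix k l :: nat assume kl: "k \<le> l"
      have "C n m k \<subseteq> C n m l" for m using C(2) kl by (rule incseqD)
      then show "F' n k \<subseteq> F' n l" unfolding F'_def using kl by (intro UN_mono) auto
    qed
    show "(\<Union>k. F' n k) = X" for n
    proof (intro equalityI subsetI)
      fix x assume "x \<in> (\<Union>k. F' n k)"
      then show "x \<in> X" using sub[of n] F(3) by blast
    next
      fix x assume "x \<in> X"
      then obtain m where "x \<in> F n m" using F(3) by blast
      then obtain k where "x \<in> C n m k" using C(3)[of n m] by blast
      moreover have "C n m k \<subseteq> C n m (max m k)" using C(2) by (simp add: incseqD)
      ultimately have "x \<in> F' n (max m k)" by (auto simp: F'_def)
      then show "x \<in> (\<Union>k. F' n k)" by blast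
    qed
  qed
  then obtain f where f: "\<forall>x\<in>X. \<forall>\<^sub>F n in sequentially. x \<in> F' n (f n)" ..
  have "\<forall>x\<in>X. \<forall>\<^sub>F n in sequentially. x \<in> F n (f n)"
  proof
    fix x assume "x \<in> X"
    with f have "\<forall>\<^sub>F n in sequentially. x \<in> F' n (f n)" ..
    then show "\<forall>\<^sub>F n in sequentially. x \<in> F n (f n)" by eventually_elim (use sub in blast)
  qed
  then show "\<exists>f. \<forall>x\<in>X. \<forall>\<^sub>F n in sequentially. x \<in> F n (f n)" by (intro exI[of _ f])
qed

section \<open>Function spaces with pointwise convergence\<close>

lemma limitin_pointwise:
  fixes s :: "nat \<Rightarrow> 'a \<Rightarrow> real"
  assumes "S \<subseteq> extensional X" "\<And>n. s n \<in> S" "y \<in> S"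
  shows "limitin (subtopology (product_topology (\<lambda>_. euclideanreal) X) S) s y sequentially
    \<longleftrightarrow> (\<forall>x\<in>X. (\<lambda>n. s n x) \<longlonglongrightarrow> y x)"
  using assms by (auto simp: limitin_subtopology limitin_componentwise subset_iff PiE_iff)

lemma seq_dense_pointwise:
  fixes D :: "('a \<Rightarrow> real) set"
  assumes S: "S \<subseteq> extensional X"
  shows "seq_dense (subtopology (product_topology (\<lambda>_. euclideanreal) X) S) D \<longleftrightarrow>
    D \<subseteq> S \<and> (\<forall>y\<in>S. \<exists>s::nat \<Rightarrow> 'a \<Rightarrow> real. (\<forall>n. s n \<in> D) \<and> (\<forall>x\<in>X. (\<lambda>n. s n x) \<longlonglongrightarrow> y x))"
proof -
  have "topspace (subtopology (product_topology (\<lambda>_. euclideanreal) X) S) = S"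
    using S by (auto simp: PiE_def)
  moreover have "(\<exists>s. (\<forall>n. s n \<in> D) \<and> limitin (subtopology (product_topology (\<lambda>_. euclideanreal) X) S) s y sequentially)
     \<longleftrightarrow> (\<exists>s. (\<forall>n. s n \<in> D) \<and> (\<forall>x\<in>X. (\<lambda>n. s n x) \<longlonglongrightarrow> y x))" if D: "D \<subseteq> S" and y: "y \<in> S" for y
  proof (intro ex_cong1 conj_cong refl)
    fix s :: "nat \<Rightarrow> 'a \<Rightarrow> real" assume "\<forall>n. s n \<in> D"
    then have "s n \<in> S" for n using D by blast
    then show "limitin (subtopology (product_topology (\<lambda>_. euclideanreal) X) S) s y sequentially
       \<longleftrightarrow> (\<forall>x\<in>X. (\<lambda>n. s n x) \<longlonglongrightarrow> y x)"
      using limitin_pointwise[OF S _ y] by simp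
  qed
  ultimately show ?thesis unfolding seq_dense_def by auto
qed

lemma Baire1_funs_iff:
  "f \<in> Baire1_funs X \<longleftrightarrow> f \<in> extensional X \<and> fsigma_approximable X f"
proof
  assume "f \<in> Baire1_funs X"
  then show "f \<in> extensional X \<and> fsigma_approximable X f"
    unfolding Baire1_funs_def using limit_imp_fsigma_approximable by blast
next
  assume f: "f \<in> extensional X \<and> fsigma_approximable X f"
  then obtain g :: "nat \<Rightarrow> real \<Rightarrow> real" where "\<And>n. continuous_on UNIV (g n)"
    "\<And>x. x \<in> X \<Longrightarrow> (\<lambda>n. g n x) \<longlonglongrightarrow> f x"
    using fsigma_approximable_imp_limit[of X f] by auto
  then show "f \<in> Baire1_funs X"
    using f by (auto simp: Baire1_funs_def intro!: exI[of _ g] intro: continuous_on_subset)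
qed

lemma Baire1_funs_subset_Borel_funs: "Baire1_funs X \<subseteq> Borel_funs X"
proof
  fix f assume "f \<in> Baire1_funs X"
  then obtain g :: "nat \<Rightarrow> real \<Rightarrow> real" where f: "f \<in> extensional X"
    and g: "\<forall>n. continuous_on X (g n)" "\<forall>x\<in>X. (\<lambda>n. g n x) \<longlonglongrightarrow> f x"
    by (auto simp: Baire1_funs_def)
  have "f \<in> borel_measurable (restrict_space borel X)"
  proof (rule borel_measurable_LIMSEQ_real)
    show "(\<lambda>n. g n x) \<longlonglongrightarrow> f x" if "x \<in> space (restrict_space borel X)" for x
      using that g(2) by (simp add: space_restrict_space)
    show "g n \<in> borel_measurable (restrict_space borel X)" for n
      using g(1) by (simp add: borel_measurable_continuous_on_restrict)
  qed
  then show "f \<in> Borel_funs X" using f by (simp add: Borel_funs_def)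
qed

text \<open>The preimages of the intervals between consecutive multiples of \<open>e\<close> are
  Borel, hence F-sigma under the selection property, and they cover \<open>X\<close>.\<close>

lemma Borel_funs_eq_Baire1_funs:
  assumes sel: "increasing_selection X {C. closedin (top_of_set X) C}"
  shows "Borel_funs X = Baire1_funs X"
proof (intro equalityI Baire1_funs_subset_Borel_funs subsetI)
  fix f assume "f \<in> Borel_funs X"
  then have f: "f \<in> extensional X" "f \<in> borel_measurable (restrict_space borel X)"
    by (auto simp: Borel_funs_def)
  have "fsigma_approximable X f"
    unfolding fsigma_approximable_def
  proof (intro allI impI)
    fix e :: real assume e: "e > 0"
    define A where "A k = {x\<in>X. e * of_int k \<le> f x \<and> f x \<le> e * (of_int k + 1)}" for k :: int
    have "A k \<in> sets (restrict_space borel X)" for k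
    proof -
      have "A k = f -` {e * of_int k .. e * (of_int k + 1)} \<inter> space (restrict_space borel X)"
        by (auto simp: A_def space_restrict_space)
      also have "\<dots> \<in> sets (restrict_space borel X)"
        using f(2) by (rule measurable_sets) simp
      finally show ?thesis .
    qed
    then have "fsigma_in (top_of_set X) (A k)" for k
      by (rule borel_imp_fsigma_if_selection[OF sel])
    moreover have "\<forall>x\<in>A k. \<bar>f x - e * of_int k\<bar> \<le> e" for k
      using e by (auto simp: A_def algebra_simps)
    moreover have "X \<subseteq> \<Union>(range A)"
    proof
      fix x assume x: "x \<in> X"
      have "of_int \<lfloor>f x / e\<rfloor> \<le> f x / e" "f x / e \<le> of_int \<lfloor>f x / e\<rfloor> + 1"
        by linarith+
      then have "e * of_int \<lfloor>f x / e\<rfloor> \<le> e * (f x / e)" "e * (f x / e) \<le> e * (of_int \<lfloor>f x / e\<rfloor> + 1)"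
        using e by (intro mult_left_mono; simp)+
      moreover have "e * (f x / e) = f x" using e by simp
      ultimately have "x \<in> A \<lfloor>f x / e\<rfloor>" using x unfolding A_def by simp
      then show "x \<in> \<Union>(range A)" by blast
    qed
    ultimately show "\<exists>\<A>. countable \<A> \<and> X \<subseteq> \<Union>\<A> \<and>
        (\<forall>A\<in>\<A>. fsigma_in (top_of_set X) A \<and> (\<exists>q. \<forall>x\<in>A. \<bar>f x - q\<bar> \<le> e))"
      by (intro exI[of _ "range A"]) auto
  qed
  with f show "f \<in> Baire1_funs X" by (simp add: Baire1_funs_iff)
qed

section \<open>Sequential separability of the first Baire class\<close>

text \<open>Weierstrass approximation followed by rounding the coefficients. As
  \<open>r \<ge> 1\<close>, all powers up to \<open>n\<close> are bounded by \<open>r ^ n\<close>,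
  so one tolerance \<open>d\<close> serves every coefficient. Coefficient lists make the
  approximants countable.\<close>

lemma rational_polynomial_approximation:
  fixes h :: "real \<Rightarrow> real"
  assumes h: "continuous_on {-r..r} h" and r: "r \<ge> 1" and e: "e > 0"
  shows "\<exists>l\<in>lists \<rat>. \<forall>x\<in>{-r..r}. \<bar>h x - (\<Sum>i<length l. l ! i * x ^ i)\<bar> < e"
proof -
  obtain g where "real_polynomial_function g" and g: "\<And>x. x \<in> {-r..r} \<Longrightarrow> \<bar>h x - g x\<bar> < e/2"
    using Stone_Weierstrass_real_polynomial_function[of "{-r..r}" h "e/2"] h e by auto
  then obtain a n where a: "g = (\<lambda>x. \<Sum>i\<le>n. a i * x ^ i)"
    by (auto simp: real_polynomial_function_iff_sum)
  define d where "d = e / (2 * (real (Suc n) * r ^ n))"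
  have pos: "real (Suc n) * r ^ n > 0" using r by (intro mult_pos_pos zero_less_power) auto
  then have d: "d > 0" using e by (simp add: d_def)
  have "\<forall>i. \<exists>b. b \<in> \<rat> \<and> \<bar>a i - b\<bar> \<le> d"
  proof
    fix i
    obtain b where "b \<in> \<rat>" "a i - d < b" "b < a i + d"
      using Rats_dense_in_real[of "a i - d" "a i + d"] d by auto
    then show "\<exists>b. b \<in> \<rat> \<and> \<bar>a i - b\<bar> \<le> d" by (intro exI[of _ b]) auto
  qed
  from choice[OF this] obtain b where b: "\<forall>i. b i \<in> \<rat> \<and> \<bar>a i - b i\<bar> \<le> d" ..
  define l where "l = map b [0..<Suc n]"
  have "l \<in> lists \<rat>" using b by (auto simp: l_def)
  moreover have "\<bar>h x - (\<Sum>i<length l. l ! i * x ^ i)\<bar> < e" if x: "x \<in> {-r..r}" for x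
  proof -
    have "(\<Sum>i<length l. l ! i * x ^ i) = (\<Sum>i<Suc n. b i * x ^ i)"
      unfolding l_def by (intro sum.cong) (auto simp del: upt_Suc)
    then have eq: "(\<Sum>i<length l. l ! i * x ^ i) = (\<Sum>i\<le>n. b i * x ^ i)"
      by (simp add: lessThan_Suc_atMost)
    have "\<bar>g x - (\<Sum>i\<le>n. b i * x ^ i)\<bar> = \<bar>\<Sum>i\<le>n. (a i - b i) * x ^ i\<bar>"
      by (simp add: a sum_subtractf left_diff_distrib)
    also have "\<dots> \<le> (\<Sum>i\<le>n. \<bar>(a i - b i) * x ^ i\<bar>)" by (rule sum_abs)
    also have "\<dots> \<le> (\<Sum>i\<le>n. d * r ^ n)"
    proof (rule sum_mono)
      fix i assume i: "i \<in> {..n}"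
      have "\<bar>x\<bar> ^ i \<le> r ^ i" using x by (intro power_mono) auto
      also have "\<dots> \<le> r ^ n" using i r by (intro power_increasing) auto
      finally have "\<bar>x\<bar> ^ i \<le> r ^ n" .
      then have "\<bar>a i - b i\<bar> * \<bar>x\<bar> ^ i \<le> d * r ^ n" using b d by (intro mult_mono) auto
      then show "\<bar>(a i - b i) * x ^ i\<bar> \<le> d * r ^ n" by (simp add: abs_mult power_abs)
    qed
    also have "\<dots> = d * (real (Suc n) * r ^ n)" by simp
    also have "\<dots> = e / 2" unfolding d_def using pos by (simp add: field_simps)
    finally show ?thesis using g[OF x] unfolding eq by linarith
  qed
  ultimately show ?thesis by blast
qed

lemma Baire1_funs_extensional: "Baire1_funs X \<subseteq> extensional X"
  by (auto simp: Baire1_funs_def)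

lemma Borel_funs_extensional: "Borel_funs X \<subseteq> extensional X"
  by (auto simp: Borel_funs_def)

lemma Baire1_funs_if_continuous:
  assumes "continuous_on X f" shows "restrict f X \<in> Baire1_funs X"
  unfolding Baire1_funs_def using assms by (auto intro!: exI[of _ "\<lambda>_. f"])

text \<open>The rational polynomials are sequentially dense: the \<open>n\<close>-th approximant is
  matched up to \<open>1/(n+1)\<close> on the interval from \<open>-(n+1)\<close> to
  \<open>n+1\<close>, and each point lies in almost all of these intervals.\<close>

lemma seq_separable_Baire1: "seq_separable (B1sp X)"
proof -
  define P where "P l = restrict (\<lambda>x::real. \<Sum>i<length l. l ! i * x ^ i) X" for l
  define D where "D = P ` lists \<rat>"
  have "countable D" unfolding D_def by (intro countable_image countable_lists countable_rat)
  moreover have "seq_dense (B1sp X) D"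
    unfolding B1sp_def seq_dense_pointwise[OF Baire1_funs_extensional]
  proof (intro conjI ballI)
    show "D \<subseteq> Baire1_funs X"
      unfolding D_def P_def by (auto intro!: Baire1_funs_if_continuous continuous_intros)
    fix y assume "y \<in> Baire1_funs X"
    \<comment> \<open>This detour replaces approximants continuous on \<open>X\<close> by ones
      continuous on the whole line, which can be restricted to compact intervals.\<close>
    then have "fsigma_approximable X y" by (simp add: Baire1_funs_iff)
    then obtain g :: "nat \<Rightarrow> real \<Rightarrow> real" where g: "\<And>n. continuous_on UNIV (g n)"
      "\<And>x. x \<in> X \<Longrightarrow> (\<lambda>n. g n x) \<longlonglongrightarrow> y x"
      by (rule fsigma_approximable_imp_limit) auto
    have "\<forall>n. \<exists>l. l \<in> lists \<rat> \<and> (\<forall>x\<in>{-real (Suc n)..real (Suc n)}.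
       \<bar>g n x - (\<Sum>i<length l. l ! i * x ^ i)\<bar> < inverse (real (Suc n)))"
    proof
      fix n
      have "continuous_on {-real (Suc n)..real (Suc n)} (g n)"
        using g(1) by (rule continuous_on_subset) simp
      from rational_polynomial_approximation[OF this, of "inverse (real (Suc n))"]
      show "\<exists>l. l \<in> lists \<rat> \<and> (\<forall>x\<in>{-real (Suc n)..real (Suc n)}.
        \<bar>g n x - (\<Sum>i<length l. l ! i * x ^ i)\<bar> < inverse (real (Suc n)))"
        by auto
    qed
    from choice[OF this] obtain l where l: "\<forall>n. l n \<in> lists \<rat> \<and> (\<forall>x\<in>{-real (Suc n)..real (Suc n)}.
       \<bar>g n x - (\<Sum>i<length (l n). l n ! i * x ^ i)\<bar> < inverse (real (Suc n)))" ..
    have "(\<lambda>n. P (l n) x) \<longlonglongrightarrow> y x" if x: "x \<in> X" for x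
    proof -
      obtain M :: nat where M: "\<bar>x\<bar> \<le> real M" using real_arch_simple by blast
      have "(\<lambda>n. g n x - P (l n) x) \<longlonglongrightarrow> 0"
      proof (rule Lim_null_comparison)
        show "\<forall>\<^sub>F n in sequentially. norm (g n x - P (l n) x) \<le> inverse (real (Suc n))"
          using eventually_ge_at_top[of M]
        proof eventually_elim
          case (elim n)
          then have "x \<in> {-real (Suc n)..real (Suc n)}" using M by auto
          then have "\<bar>g n x - (\<Sum>i<length (l n). l n ! i * x ^ i)\<bar> < inverse (real (Suc n))"
            using l by blast
          then show ?case using x by (simp add: P_def)
        qed
        show "(\<lambda>n. inverse (real (Suc n))) \<longlonglongrightarrow> 0" by (rule LIMSEQ_inverse_real_of_nat)
      qed
      from tendsto_diff[OF g(2)[OF x] this] show ?thesis by simp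
    qed
    moreover have "\<forall>n. P (l n) \<in> D" using l by (simp add: D_def)
    ultimately show "\<exists>s::nat \<Rightarrow> real \<Rightarrow> real. (\<forall>n. s n \<in> D) \<and> (\<forall>x\<in>X. (\<lambda>n. s n x) \<longlonglongrightarrow> y x)"
      by (intro exI[of _ "\<lambda>n. P (l n)"]) simp
  qed
  ultimately show ?thesis unfolding seq_separable_def by blast
qed

section \<open>Selection of sequentially dense sets\<close>

lemma S1_SeqD_if_increasing_selection:
  fixes S :: "(real \<Rightarrow> real) set"
  assumes sel: "increasing_selection X (sets (restrict_space borel X))"
    and S: "S \<subseteq> Borel_funs X" "S \<noteq> {}"
  defines "T \<equiv> subtopology (product_topology (\<lambda>_. euclideanreal) X) S"
  assumes sep: "seq_separable T"
  shows "S1 (SeqD T) (SeqD T)"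
  unfolding S1_def
proof (intro allI impI)
  fix A :: "nat \<Rightarrow> (real \<Rightarrow> real) set"
  assume A: "\<forall>n. A n \<in> SeqD T"
  have Sext: "S \<subseteq> extensional X" using S Borel_funs_extensional by blast
  note dense = seq_dense_pointwise[OF Sext, folded T_def]
  obtain D where D: "countable D" "seq_dense T D" using sep by (auto simp: seq_separable_def)
  have DS: "D \<subseteq> S" using D(2) dense by simp
  have Dd: "\<exists>s::nat \<Rightarrow> real \<Rightarrow> real. (\<forall>n. s n \<in> D) \<and> (\<forall>x\<in>X. (\<lambda>n. s n x) \<longlonglongrightarrow> y x)" if "y \<in> S" for y
    using D(2) dense that by simp
  have "D \<noteq> {}" using S(2) Dd by blast
  define d where "d = from_nat_into D"
  have d: "range d = D" unfolding d_def using \<open>D \<noteq> {}\<close> D(1) by (rule range_from_nat_into)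
  \<comment> \<open>Stage \<open>n\<close> codes a task: approximate the target
    \<open>d (p n)\<close> from \<open>A n\<close> with precision
    \<open>(1/2) ^ r n\<close>.\<close>
  define p where "p n = fst (prod_decode n)" for n
  define r where "r n = snd (prod_decode n)" for n
  have AS: "A n \<subseteq> S" for n
    using A dense by (simp add: SeqD_def)
  have "\<forall>n. \<exists>s::nat \<Rightarrow> real \<Rightarrow> real. (\<forall>j. s j \<in> A n) \<and> (\<forall>x\<in>X. (\<lambda>j. s j x) \<longlonglongrightarrow> d (p n) x)"
  proof
    fix n
    have "d (p n) \<in> S" using d DS by blast
    moreover have "seq_dense T (A n)" using A by (simp add: SeqD_def)
    ultimately show "\<exists>s::nat \<Rightarrow> real \<Rightarrow> real. (\<forall>j. s j \<in> A n) \<and> (\<forall>x\<in>X. (\<lambda>j. s j x) \<longlonglongrightarrow> d (p n) x)"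
      using dense by simp
  qed
  from choice[OF this] obtain s :: "nat \<Rightarrow> nat \<Rightarrow> real \<Rightarrow> real" where
    s: "\<forall>n. (\<forall>j. s n j \<in> A n) \<and> (\<forall>x\<in>X. (\<lambda>j. s n j x) \<longlonglongrightarrow> d (p n) x)" ..
  define F where "F n m = {x\<in>X. \<forall>j\<ge>m. \<bar>s n j x - d (p n) x\<bar> \<le> (1/2) ^ r n}" for n m
  have "\<exists>f. \<forall>x\<in>X. \<forall>\<^sub>F n in sequentially. x \<in> F n (f n)"
  proof (rule increasing_selectionD[OF sel])
    let ?M = "restrict_space borel X"
    fix n
    have Sm: "h \<in> borel_measurable ?M" if "h \<in> S" for h using that S(1) by (auto simp: Borel_funs_def)
    have [measurable]: "s n j \<in> borel_measurable ?M" for j using Sm s AS by blast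
    have [measurable]: "d i \<in> borel_measurable ?M" for i using Sm d DS by blast
    have "F n m = {x\<in>space ?M. \<forall>j\<in>{m..}. \<bar>s n j x - d (p n) x\<bar> \<le> (1/2) ^ r n}" for m
      by (auto simp: F_def space_restrict_space)
    also have "\<dots> m \<in> sets ?M" for m by measurable
    finally show "F n m \<in> sets ?M" for m .
    show "incseq (F n)" by (rule incseq_SucI) (auto simp: F_def)
    show "(\<Union>m. F n m) = X"
    proof (intro equalityI subsetI)
      fix x assume x: "x \<in> X"
      have "\<forall>\<^sub>F j in sequentially. dist (s n j x) (d (p n) x) < (1/2) ^ r n"
        using s x by (intro tendstoD) auto
      then obtain m where "\<forall>j\<ge>m. dist (s n j x) (d (p n) x) < (1/2) ^ r n"
        by (auto simp: eventually_sequentially)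
      then have "x \<in> F n m" using x by (auto simp: F_def dist_real_def less_imp_le)
      then show "x \<in> (\<Union>m. F n m)" by blast
    qed (auto simp: F_def)
  qed
  then obtain f where f: "\<forall>x\<in>X. \<forall>\<^sub>F n in sequentially. x \<in> F n (f n)" ..
  define b where "b n = s n (f n)" for n
  have bA: "\<forall>n. b n \<in> A n" using s by (simp add: b_def)
  have "seq_dense T (range b)"
    unfolding dense
  proof (intro conjI ballI)
    show "range b \<subseteq> S" using bA AS by blast
    fix y assume "y \<in> S"
    from Dd[OF this] obtain t :: "nat \<Rightarrow> real \<Rightarrow> real" where t: "\<forall>n. t n \<in> D" "\<forall>x\<in>X. (\<lambda>n. t n x) \<longlonglongrightarrow> y x"
      by auto
    have "\<forall>k. \<exists>i. d i = t k" using t(1) d by (metis rangeE)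
    from choice[OF this] obtain a where a: "\<forall>k. d (a k) = t k" ..
    \<comment> \<open>Stage \<open>v k\<close> aims at \<open>t k\<close> with precision
      \<open>(1/2) ^ k\<close>. Since \<open>v k\<close> is at least \<open>k\<close>, what holds at
      almost all stages holds at almost all \<open>v k\<close>.\<close>
    define v where "v k = prod_encode (a k, k)" for k
    have v: "filterlim v at_top sequentially"
      by (rule filterlim_at_top_mono[OF filterlim_ident]) (simp add: v_def le_prod_encode_2)
    have "(\<lambda>k. b (v k) x) \<longlonglongrightarrow> y x" if x: "x \<in> X" for x
    proof -
      from f x have "\<forall>\<^sub>F n in sequentially. x \<in> F n (f n)" ..
      then have "\<forall>\<^sub>F k in sequentially. x \<in> F (v k) (f (v k))"
        using v by (rule eventually_compose_filterlim)
      then have "\<forall>\<^sub>F k in sequentially. norm (b (v k) x - t k x) \<le> (1/2) ^ k"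
        by eventually_elim (use a in \<open>simp add: F_def b_def v_def p_def r_def\<close>)
      then have "(\<lambda>k. b (v k) x - t k x) \<longlonglongrightarrow> 0"
        by (rule Lim_null_comparison) (simp add: LIMSEQ_power_zero)
      moreover have "(\<lambda>k. t k x) \<longlonglongrightarrow> y x" using t(2) x by simp
      ultimately have "(\<lambda>k. (b (v k) x - t k x) + t k x) \<longlonglongrightarrow> 0 + y x" by (rule tendsto_add)
      then show ?thesis by simp
    qed
    then show "\<exists>s::nat \<Rightarrow> real \<Rightarrow> real. (\<forall>n. s n \<in> range b) \<and> (\<forall>x\<in>X. (\<lambda>n. s n x) \<longlonglongrightarrow> y x)"
      by (intro exI[of _ "\<lambda>k. b (v k)"]) simp
  qed
  then have "range b \<in> SeqD T" by (simp add: SeqD_def)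
  with bA show "\<exists>b. (\<forall>n. b n \<in> A n) \<and> range b \<in> SeqD T" by (intro exI[of _ b]) simp
qed

text \<open>Stated for a general \<open>S\<close> to cover both function spaces. The assumption
  \<open>pieces\<close> admits the functions that keep a member of \<open>S\<close> on a closed set
  and take the value 2 elsewhere. Where an approximation of a constant below 1 has dropped under 2,
  the point must lie in that closed set.\<close>

lemma increasing_selection_if_Sfin_SeqD:
  fixes S :: "('a::topological_space \<Rightarrow> real) set"
  assumes S: "S \<subseteq> extensional X" "\<And>c. (\<lambda>x\<in>X. c) \<in> S"
    and pieces: "\<And>C d c. closedin (top_of_set X) C \<Longrightarrow> d \<in> S \<Longrightarrow> (\<lambda>x\<in>X. if x \<in> C then d x else c) \<in> S"
  defines "T \<equiv> subtopology (product_topology (\<lambda>_. euclideanreal) X) S"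
  assumes sep: "seq_separable T" and Sfin: "Sfin (SeqD T) (SeqD T)"
  shows "increasing_selection X {C. closedin (top_of_set X) C}"
  unfolding increasing_selection_def
proof (intro allI impI, elim conjE)
  fix F :: "nat \<Rightarrow> nat \<Rightarrow> 'a set"
  assume F: "\<forall>n m. F n m \<in> {C. closedin (top_of_set X) C}" "\<forall>n. incseq (F n)" "\<forall>n. (\<Union>m. F n m) = X"
  define E where "E = (\<lambda>n m. \<Inter>i\<le>n. F i m)"
  have E: "E n m \<in> {C. closedin (top_of_set X) C}" "incseq (E n)" "(\<Union>m. E n m) = X"
    "k \<le> n \<Longrightarrow> E n m \<subseteq> F k m" for n m k
    unfolding E_def
    by (rule finite_intersection_array[of "{C. closedin (top_of_set X) C}" F X]; use F in \<open>simp add: closedin_Int\<close>)+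
  note dense = seq_dense_pointwise[OF S(1), folded T_def]
  show "\<exists>f. \<forall>x\<in>X. \<forall>\<^sub>F n in sequentially. x \<in> F n (f n)"
  proof (cases "X = {}")
    case False
    then obtain x0 where x0: "x0 \<in> X" by blast
    obtain D where D: "countable D" "seq_dense T D" using sep by (auto simp: seq_separable_def)
    have DS: "D \<subseteq> S" using D(2) dense by simp
    have Dd: "\<exists>s::nat \<Rightarrow> 'a \<Rightarrow> real. (\<forall>n. s n \<in> D) \<and> (\<forall>x\<in>X. (\<lambda>n. s n x) \<longlonglongrightarrow> y x)" if "y \<in> S" for y
      using D(2) dense that by simp
    have "D \<noteq> {}" using Dd[OF S(2)] by blast
    \<comment> \<open>Each member of the dense set occurs infinitely often in this enumeration.\<close>
    define d where "d i = from_nat_into D (fst (prod_decode i))" for i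
    have dD: "d i \<in> D" for i unfolding d_def using \<open>D \<noteq> {}\<close> by (rule from_nat_into)
    \<comment> \<open>At a fixed point of \<open>X\<close> the functions \<open>g n i\<close> and
      \<open>d i\<close> differ for only finitely many \<open>i\<close>. As every member of
      \<open>D\<close> recurs at arbitrarily large indices, row \<open>n\<close> remains
      sequentially dense.\<close>
    define g where "g n i = (\<lambda>x\<in>X. if x \<in> E n i then d i x else 2)" for n i
    have gS: "g n i \<in> S" for n i
      unfolding g_def using E(1) dD DS by (intro pieces) auto
    have A: "\<forall>n. range (g n) \<in> SeqD T"
      unfolding SeqD_def dense mem_Collect_eq
    proof (intro allI conjI ballI)
      fix n
      show "countable (range (g n))" by simp
      show "range (g n) \<subseteq> S" using gS by blast
      fix y assume "y \<in> S"
      from Dd[OF this] obtain t :: "nat \<Rightarrow> 'a \<Rightarrow> real" where t: "\<forall>k. t k \<in> D" "\<forall>x\<in>X. (\<lambda>k. t k x) \<longlonglongrightarrow> y x"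
      by auto
      define v where "v k = prod_encode (to_nat_on D (t k), k)" for k
      have dv: "d (v k) = t k" for k using t(1) D(1) by (simp add: d_def v_def)
      have vk: "k \<le> v k" for k by (simp add: v_def le_prod_encode_2)
      have "(\<lambda>k. g n (v k) x) \<longlonglongrightarrow> y x" if x: "x \<in> X" for x
      proof (rule Lim_transform_eventually)
        show "(\<lambda>k. t k x) \<longlonglongrightarrow> y x" using t(2) x by simp
        obtain m where m: "x \<in> E n m" using x E(3)[of n] by auto
        show "\<forall>\<^sub>F k in sequentially. t k x = g n (v k) x"
          using eventually_ge_at_top[of m]
        proof eventually_elim
          case (elim k)
          then have "m \<le> v k" using vk[of k] by simp
          with E(2) have "E n m \<subseteq> E n (v k)" by (rule incseqD)
          then have "x \<in> E n (v k)" using m by (rule subsetD)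
          then show ?case using x by (simp add: g_def dv)
        qed
      qed
      then show "\<exists>s::nat \<Rightarrow> 'a \<Rightarrow> real. (\<forall>k. s k \<in> range (g n)) \<and> (\<forall>x\<in>X. (\<lambda>k. s k x) \<longlonglongrightarrow> y x)"
        by (intro exI[of _ "\<lambda>k. g n (v k)"]) simp
    qed
    obtain B where B: "\<forall>n. finite (B n) \<and> B n \<subseteq> range (g n)" "(\<Union>n. B n) \<in> SeqD T"
      using Sfin[unfolded Sfin_def, rule_format, of "\<lambda>n. range (g n)"] A by auto
    \<comment> \<open>A constant limit missed by all members at one point forces the approximating sequence
      to leave each of the finite sets.\<close>
    have "\<exists>c\<in>{0<..<1::real}. c \<notin> range (\<lambda>(n, i). g n i x0)"
    proof (rule ccontr)
      assume "\<not> ?thesis"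
      then have "{0<..<1::real} \<subseteq> range (\<lambda>(n, i). g n i x0)" by blast
      then have "countable {0<..<1::real}" by (rule countable_subset) simp
      then show False using uncountable_open_interval[of 0 "1::real"] by simp
    qed
    then obtain c where c: "0 < c" "c < 1" "\<And>n i. g n i x0 \<noteq> c" by force
    have "\<exists>s::nat \<Rightarrow> 'a \<Rightarrow> real. (\<forall>j. s j \<in> (\<Union>n. B n)) \<and> (\<forall>x\<in>X. (\<lambda>j. s j x) \<longlonglongrightarrow> (\<lambda>x\<in>X. c) x)"
      using B(2) S(2)[of c] unfolding SeqD_def dense mem_Collect_eq by blast
    then obtain t :: "nat \<Rightarrow> 'a \<Rightarrow> real" where tB: "\<forall>j. t j \<in> (\<Union>n. B n)"
      and tc': "\<forall>x\<in>X. (\<lambda>j. t j x) \<longlonglongrightarrow> (\<lambda>x\<in>X. c) x" by auto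
    have tc: "(\<lambda>j. t j x) \<longlonglongrightarrow> c" if "x \<in> X" for x using bspec[OF tc' that] that by simp
    \<comment> \<open>The pair \<open>q\<close> records a row whose finite set contains
      \<open>t j\<close>, and a column producing \<open>t j\<close> in that row.\<close>
    have "\<forall>j. \<exists>q. t j \<in> B (fst q) \<and> t j = g (fst q) (snd q)"
    proof
      fix j
      obtain n where n: "t j \<in> B n" using tB by auto
      moreover obtain i where "t j = g n i" using n B(1) by blast
      ultimately show "\<exists>q. t j \<in> B (fst q) \<and> t j = g (fst q) (snd q)"
        by (intro exI[of _ "(n, i)"]) simp
    qed
    from choice[OF this] obtain q where q: "\<forall>j. t j \<in> B (fst (q j)) \<and> t j = g (fst (q j)) (snd (q j))" ..
    have "\<forall>k. \<exists>j. j \<ge> k \<and> fst (q j) \<ge> k"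
    proof
      fix k
      have "\<forall>\<^sub>F j in sequentially. \<forall>w\<in>(\<Union>n<k. B n). t j \<noteq> w"
      proof (rule eventually_ball_finite)
        show "finite (\<Union>n<k. B n)" using B(1) by simp
        show "\<forall>w\<in>(\<Union>n<k. B n). \<forall>\<^sub>F j in sequentially. t j \<noteq> w"
        proof
          fix w assume "w \<in> (\<Union>n<k. B n)"
          then have "w x0 \<noteq> c" using B(1) c(3) by blast
          then have "\<forall>\<^sub>F j in sequentially. t j x0 \<noteq> w x0"
            using tc[OF x0] by (intro tendsto_imp_eventually_ne) auto
          then show "\<forall>\<^sub>F j in sequentially. t j \<noteq> w" by eventually_elim auto
        qed
      qed
      then have "\<forall>\<^sub>F j in sequentially. j \<ge> k \<and> fst (q j) \<ge> k"
        using eventually_ge_at_top[of k]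
      proof eventually_elim
        case (elim j)
        have "t j \<in> B (fst (q j))" using q by blast
        then have "\<not> fst (q j) < k" using elim(1) by blast
        then show ?case using elim(2) by simp
      qed
      then show "\<exists>j. j \<ge> k \<and> fst (q j) \<ge> k" by (auto simp: eventually_sequentially)
    qed
    from choice[OF this] obtain J where J: "\<forall>k. J k \<ge> k \<and> fst (q (J k)) \<ge> k" ..
    have Jlim: "filterlim J at_top sequentially"
      by (rule filterlim_at_top_mono[OF filterlim_ident]) (use J in simp)
    \<comment> \<open>Once \<open>t (J k) x\<close> is below 2, \<open>x\<close> lies in the
      \<open>E\<close>-set of a row not before \<open>k\<close>, which is contained in the set of
      \<open>F k\<close> with the same column.\<close>
    have "\<forall>x\<in>X. \<forall>\<^sub>F k in sequentially. x \<in> F k (snd (q (J k)))"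
    proof
      fix x assume x: "x \<in> X"
      have "\<forall>\<^sub>F j in sequentially. t j x < 2"
        using tc[OF x] c(2) by (intro order_tendstoD(2)) auto
      then have "\<forall>\<^sub>F k in sequentially. t (J k) x < 2"
        using Jlim by (rule eventually_compose_filterlim)
      then show "\<forall>\<^sub>F k in sequentially. x \<in> F k (snd (q (J k)))"
      proof eventually_elim
        case (elim k)
        have "t (J k) x = g (fst (q (J k))) (snd (q (J k))) x" using q by simp
        then have "x \<in> E (fst (q (J k))) (snd (q (J k)))"
          using elim x by (auto simp: g_def split: if_splits)
        then show ?case using E(4)[of k "fst (q (J k))" "snd (q (J k))"] J by auto
      qed
    qed
    then show ?thesis by (intro exI[of _ "\<lambda>k. snd (q (J k))"])
  qed simp
qed

text \<open>An F-sigma cover for \<open>d\<close> is intersected with \<open>C\<close> and completed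
  by the complement of \<open>C\<close>, which is relatively open and therefore F-sigma.\<close>

lemma Baire1_funs_pieces:
  assumes C: "closedin (top_of_set X) C" and d: "d \<in> Baire1_funs X"
  shows "(\<lambda>x\<in>X. if x \<in> C then d x else c) \<in> Baire1_funs X"
proof -
  have "fsigma_approximable X (\<lambda>x\<in>X. if x \<in> C then d x else c)"
    unfolding fsigma_approximable_def
  proof (intro allI impI)
    fix e :: real assume e: "e > 0"
    then have "\<exists>\<A>. countable \<A> \<and> X \<subseteq> \<Union>\<A> \<and>
        (\<forall>A\<in>\<A>. fsigma_in (top_of_set X) A \<and> (\<exists>q. \<forall>x\<in>A. \<bar>d x - q\<bar> \<le> e))"
      using d unfolding Baire1_funs_iff fsigma_approximable_def by simp
    then obtain \<A> where \<A>: "countable \<A>" "X \<subseteq> \<Union>\<A>"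
      "\<forall>A\<in>\<A>. fsigma_in (top_of_set X) A \<and> (\<exists>q. \<forall>x\<in>A. \<bar>d x - q\<bar> \<le> e)" by auto
    define \<B> where "\<B> = insert (X - C) ((\<lambda>A. A \<inter> C) ` \<A>)"
    have "countable \<B>" "X \<subseteq> \<Union>\<B>" using \<A>(1,2) by (auto simp: \<B>_def)
    moreover have "fsigma_in (top_of_set X) B \<and>
      (\<exists>q. \<forall>x\<in>B. \<bar>(\<lambda>x\<in>X. if x \<in> C then d x else c) x - q\<bar> \<le> e)" if B: "B \<in> \<B>" for B
    proof (cases "B = X - C")
      case True
      have "openin (top_of_set X) (X - C)" using C by (simp add: openin_diff)
      then have "fsigma_in (top_of_set X) B"
        unfolding True by (intro open_imp_fsigma_in metrizable_space_subtopology metrizable_space_euclidean)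
      then show ?thesis using True e by (auto intro!: exI[of _ c])
    next
      case False
      then obtain A where A: "A \<in> \<A>" "B = A \<inter> C" using B by (auto simp: \<B>_def)
      obtain q where "\<forall>x\<in>A. \<bar>d x - q\<bar> \<le> e" using \<A>(3) A(1) by auto
      moreover have "C \<subseteq> X" using C by (rule closedin_imp_subset)
      ultimately have "\<forall>x\<in>B. \<bar>(\<lambda>x\<in>X. if x \<in> C then d x else c) x - q\<bar> \<le> e"
        using A(2) by auto
      moreover have "fsigma_in (top_of_set X) B"
        unfolding A(2) using \<A>(3) A(1) closed_imp_fsigma_in[OF C] by (intro fsigma_in_Int) auto
      ultimately show ?thesis by blast
    qed
    ultimately show "\<exists>\<A>. countable \<A> \<and> X \<subseteq> \<Union>\<A> \<and> (\<forall>A\<in>\<A>. fsigma_in (top_of_set X) A \<and>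
        (\<exists>q. \<forall>x\<in>A. \<bar>(\<lambda>x\<in>X. if x \<in> C then d x else c) x - q\<bar> \<le> e))"
      by (intro exI[of _ \<B>]) blast
  qed
  then show ?thesis by (simp add: Baire1_funs_iff)
qed

lemma closedin_imp_borel_restrict:
  assumes "closedin (top_of_set X) C" shows "C \<in> sets (restrict_space borel X)"
  using assms by (auto simp: closedin_closed sets_restrict_space)

lemma Borel_funs_pieces:
  assumes C: "closedin (top_of_set X) C" and d: "d \<in> Borel_funs X"
  shows "(\<lambda>x\<in>X. if x \<in> C then d x else c) \<in> Borel_funs X"
proof -
  let ?M = "restrict_space borel X"
  have [measurable]: "C \<in> sets ?M" "d \<in> borel_measurable ?M"
    using closedin_imp_borel_restrict[OF C] d by (auto simp: Borel_funs_def)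
  have "(\<lambda>x. if x \<in> C then d x else c) \<in> borel_measurable ?M" by measurable
  then have "(\<lambda>x\<in>X. if x \<in> C then d x else c) \<in> borel_measurable ?M"
    by (rule measurable_cong[THEN iffD1, rotated]) (simp add: space_restrict_space)
  then show ?thesis by (simp add: Borel_funs_def)
qed

section \<open>Assembling the equivalences around the selection property of closed sets\<close>

lemma BGamma_eq: "BGamma X = gamma_covers X (sets (restrict_space borel X))"
  by (simp add: BGamma_def gamma_covers_def)

lemma FGamma_eq: "FGamma X = gamma_covers X {C. closedin (top_of_set X) C}"
  by (auto simp: FGamma_def gamma_covers_def)

theorem theorem3p1:
  fixes X :: "real set"
  shows "((S1 (SeqD (Bsp X)) (SeqD (Bsp X)) \<and> seq_separable (Bsp X))
            \<longleftrightarrow> S1 (BGamma X) (BGamma X))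
       \<and> (S1 (BGamma X) (BGamma X)
            \<longleftrightarrow> (Sfin (SeqD (Bsp X)) (SeqD (Bsp X)) \<and> seq_separable (Bsp X)))
       \<and> ((Sfin (SeqD (Bsp X)) (SeqD (Bsp X)) \<and> seq_separable (Bsp X))
            \<longleftrightarrow> Sfin (BGamma X) (BGamma X))
       \<and> (Sfin (BGamma X) (BGamma X) \<longleftrightarrow> S1 (SeqD (B1sp X)) (SeqD (B1sp X)))
       \<and> (S1 (SeqD (B1sp X)) (SeqD (B1sp X)) \<longleftrightarrow> S1 (FGamma X) (FGamma X))
       \<and> (S1 (FGamma X) (FGamma X) \<longleftrightarrow> Sfin (SeqD (B1sp X)) (SeqD (B1sp X)))"
proof -
  define sel where "sel \<longleftrightarrow> increasing_selection X {C. closedin (top_of_set X) C}"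
  have const: "(\<lambda>x\<in>X. c) \<in> Baire1_funs X" for c
    by (intro Baire1_funs_if_continuous continuous_intros)
  \<comment> \<open>Under \<open>sel\<close> the two function spaces coincide, so
    \<open>Bsp X\<close> inherits both \<open>S1\<close> and sequential separability from
    \<open>B1sp X\<close>.\<close>
  have Bsp_eq: "Bsp X = B1sp X" if sel
    using Borel_funs_eq_Baire1_funs that unfolding sel_def Bsp_def B1sp_def by simp
  have S1_B1: "S1 (SeqD (B1sp X)) (SeqD (B1sp X))" if sel
    unfolding B1sp_def
  proof (rule S1_SeqD_if_increasing_selection)
    show "increasing_selection X (sets (restrict_space borel X))"
      using that unfolding sel_def by (rule increasing_selection_borel)
    show "Baire1_funs X \<noteq> {}" using const by blast
  qed (use Baire1_funs_subset_Borel_funs seq_separable_Baire1 in \<open>auto simp: B1sp_def\<close>)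
  have S1_BG: "S1 (BGamma X) (BGamma X)" if sel
    unfolding BGamma_eq
  proof (rule S1_if_increasing_selection)
    show "increasing_selection X (sets (restrict_space borel X))"
      using that unfolding sel_def by (rule increasing_selection_borel)
  qed (auto intro: sets.countable_INT)
  have S1_FG: "S1 (FGamma X) (FGamma X)" if sel
    unfolding FGamma_eq
    by (rule S1_if_increasing_selection)
      (use that in \<open>auto simp: sel_def intro!: closedin_INT\<close>)
  have sel_FG: sel if "S1 (FGamma X) (FGamma X)"
    unfolding sel_def
    by (rule increasing_selection_if_Sfin)
      (use S1_imp_Sfin[OF that] in \<open>auto simp: FGamma_eq closedin_Int\<close>)
  have sel_BG: sel if "Sfin (BGamma X) (BGamma X)"
  proof -
    have borel: "increasing_selection X (sets (restrict_space borel X))"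
      by (rule increasing_selection_if_Sfin) (use that in \<open>auto simp: BGamma_eq\<close>)
    show ?thesis
      unfolding sel_def increasing_selection_def
    proof (intro allI impI, elim conjE)
      fix F :: "nat \<Rightarrow> nat \<Rightarrow> real set"
      assume "\<forall>n m. F n m \<in> {C. closedin (top_of_set X) C}" "\<forall>n. incseq (F n)" "\<forall>n. (\<Union>m. F n m) = X"
      then show "\<exists>f. \<forall>x\<in>X. \<forall>\<^sub>F n in sequentially. x \<in> F n (f n)"
        by (intro increasing_selectionD[OF borel]) (simp_all add: closedin_imp_borel_restrict)
    qed
  qed
  have sel_B1: sel if "Sfin (SeqD (B1sp X)) (SeqD (B1sp X))"
    unfolding sel_def
    by (rule increasing_selection_if_Sfin_SeqD[of "Baire1_funs X"])
      (use Baire1_funs_extensional const Baire1_funs_pieces seq_separable_Baire1 that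
        in \<open>simp_all add: B1sp_def\<close>)
  have sel_B: sel if "Sfin (SeqD (Bsp X)) (SeqD (Bsp X))" "seq_separable (Bsp X)"
    unfolding sel_def
    by (rule increasing_selection_if_Sfin_SeqD[of "Borel_funs X"])
      (use Borel_funs_extensional subsetD[OF Baire1_funs_subset_Borel_funs const]
        Borel_funs_pieces that in \<open>simp_all add: Bsp_def\<close>)
  have S1_B: "S1 (SeqD (Bsp X)) (SeqD (Bsp X)) \<and> seq_separable (Bsp X)" if sel
    using Bsp_eq S1_B1 seq_separable_Baire1 that by simp
  show ?thesis
  \<comment> \<open>All seven statements hold if \<open>sel\<close> does, and all fail
    otherwise.\<close>
  proof (cases sel)
    case True
    then show ?thesis using S1_B S1_B1 S1_BG S1_FG by (simp add: S1_imp_Sfin)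
  next
    case False
    then show ?thesis using sel_FG sel_BG sel_B1 sel_B by (auto dest: S1_imp_Sfin)
  qed
qed

end
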